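(* Let $(A,\omega,\tau,G)$ be a weakly mixing C*-dynamical system with $\omega$ tracial, where $G$ is a second countable (abelian) topological group, $\Sigma$ its Borel $\sigma$-algebra, $\mu$ a $\sigma$-finite measure, and such that $$G^{2}\times G^{2}\rightarrow\mathbb{C}:(g,h,j,k)\mapsto\omega\left(\tau_{h}(a_{1})\tau_{g}(a_{2})\tau_{gh}(a_{3})\tau_{jk}(a_{4})\tau_{j}(a_{5})\tau_{k}(a_{6})\right)$$ is $\Sigma^{2}\times\Sigma^{2}$-measurable for all $a_1,\dots,a_6\in A$. Assume the existence of uniform Følner sequences $(\Lambda_{1,n})$ and $(\Lambda_{2,n})$ in $G$ satisfying the Tempel'man condition and such that $(\Lambda_{1,n}^{-1}\Lambda_{1,n})$ and $(\Lambda_{2,n}^{-1}\Lambda_{2,n})$ are also Følner in $G$. (1) If $(A,\omega,\tau,G)$ is asymptotically abelian with respect to $(\Lambda_{1,n})$, then $$\lim_{n\rightarrow\infty}\frac{1}{\mu(\Lambda_{1,n})\mu(\Lambda_{2,n})}\int_{\Lambda_{1,n}}\int_{\Lambda_{2,n}}\omega\left(\tau_{gh}(a)\tau_{g}(b)\tau_{h}(c)d\right)dg\,dh=\omega(a)\omega(b)\omega(c)\omega(d)$$ for all $a,b,c,d\in A$. (2) If $\mu$ is the counting measure (in particular $G$ is countable), and $(A,\omega,\tau,G)$ is uniformly asymptotically abelian with respect to $(\Lambda_{1,n})$, then $$\lim_{n\rightarrow\infty}\sup_{g_{1},g_{2}\in G}\left|\frac{1}{\mu(\Lambda_{1,n})\mu(\Lambda_{2,n})}\sum_{h\in\Lambda_{1,n}g_{1}}\sum_{g\in\Lambda_{2,n}g_{2}}\omega\left(\tau_{gh}(a)\tau_{g}(b)\tau_{h}(c)d\right)-\omega(a)\omega(b)\omega(c)\omega(d)\right|=0$$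 for all $a,b,c,d\in A$.
   Context: A topological group is a group with a topology in which product and inverse are continuous; second countable means the topology has a countable base. For subsets $V,W$ of a group, $Vg=\{vg:v\in V\}$, $VW=\{vw:v\in V,w\in W\}$, $V^{-1}=\{v^{-1}:v\in V\}$; $\Delta$ is symmetric difference. $\Sigma^2=\Sigma\times\Sigma$ is the product $\sigma$-algebra. Integrals with respect to $\mu$ are written $dg$, $dh$; in double integrals $g$ runs over the inner domain and $h$ over the outer one. A right invariant measure group $(G,\Sigma,\mu)$ is a group $G$ with a $\sigma$-algebra $\Sigma$ in $G$ and a positive measure $\mu$ on $\Sigma$ such that $Vg\in\Sigma$ and $\mu(Vg)=\mu(V)$ for all $V\in\Sigma$, $g\in G$. A net (or sequence) $(\Lambda_\alpha)$ of subsets of $G$, with $\Lambda_\alpha\in\Sigma$ for $\alpha$ large enough, is Følner in $G$ if $0<\mu(\Lambda_\alpha)<\infty$ for $\alpha$ large enough and $\lim_\alpha\mu(\Lambda_\alpha\Delta(\Lambda_\alpha g))/\mu(\Lambda_\alpha)=0$ for all $g\in G$. It is uniform Følner if moreover $\lim_\alpha\frac{1}{\mu(\Lambda_\alpha)}\sup_{g\in\Lambda_\beta}\mu(\Lambda_\alpha\Delta(\Lambda_\alpha g))=0$ for $\beta$ large enough. It satisfies the Tempel'man condition if there is a real $c>0$ with $\mu(\Lambda_\alpha^{-1}\Lambda_\alpha)\le c\,\mu(\Lambda_\alpha)$ for $\alpha$ large enough (in particular $\Lambda_\alpha^{-1}\Lambda_\alpha\in\Sigma$ for $\alpha$ large enough).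 C*-dynamical system $(A,\omega,\tau,G)$: $A$ is a unital C*-algebra, $\omega$ a state on $A$, $(G,\Sigma,\mu)$ a right invariant measure group possessing a Følner net, with $G$ abelian (written multiplicatively, identity $e$), such that $\mathcal I:g\mapsto g^{-1}$ is measurable ($\mathcal I^{-1}(\Sigma)\subset\Sigma$) and $\mu\circ\mathcal I=\mu$; $\tau:G\to\mathrm{Aut}(A)$, $g\mapsto\tau_g$, takes values in the $*$-automorphisms of $A$, $\tau_e=\mathrm{id}$, $\tau_g\circ\tau_h=\tau_{gh}$, $\omega\circ\tau_g=\omega$ for all $g,h\in G$, and $g\mapsto\omega(a\tau_g(b))$ is $\Sigma$-measurable for all $a,b\in A$. $\omega$ is tracial if $\omega(ab)=\omega(ba)$ for all $a,b\in A$. The system is weakly mixing if for some (equivalently, every) Følner net $(\Lambda_\alpha)$ in $G$, $\lim_\alpha\frac1{\mu(\Lambda_\alpha)}\int_{\Lambda_\alpha}|\omega(a\tau_g(b))-\omega(a)\omega(b)|\,dg=0$ for all $a,b\in A$. Let $[a,b]=ab-ba$ and let $(\Lambda_\alpha)$ be a Følner net in $G$. The system is asymptotically abelian with respect to $(\Lambda_\alpha)$ if $g\mapsto\|[a,\tau_g(b)]\|$ is $\Sigma$-measurable and $\lim_\alpha\frac1{\mu(\Lambda_\alpha)}\int_{\Lambda_\alpha}\|[a,\tau_g(b)]\|\,dg=0$ for all $a,b\in A$. It is uniformly asymptotically abelian with respect to $(\Lambda_\alpha)$ if $g\mapsto\|[a,\tau_g(b)]\|$ is $\Sigma$-measurable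 and $\lim_\alpha\sup_{h\in G}\frac1{\mu(\Lambda_\alpha)}\int_{\Lambda_\alpha h}\|[a,\tau_g(b)]\|\,dg=0$ for all $a,b\in A$. *)

theory Defs
  imports "HOL-Analysis.Analysis"
begin

section \<open>Unital C*-algebras, states and *-automorphisms\<close>

text \<open>
  The class \<^class>\<open>real_normed_algebra_1\<close> requires \<open>norm 1 = 1\<close>, which excludes exactly the zero
  algebra. The zero algebra has no state, so it carries no C*-dynamical system.
\<close>

class unital_cstar_algebra = real_normed_algebra_1 + banach +
  fixes scaleC :: "complex \<Rightarrow> 'a \<Rightarrow> 'a"  (infixr \<open>*\<^sub>C\<close> 75)
    and star :: "'a \<Rightarrow> 'a"
  assumes scaleC_add_right: "c *\<^sub>C (a + b) = c *\<^sub>C a + c *\<^sub>C b"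
    and scaleC_add_left: "(c + d) *\<^sub>C a = c *\<^sub>C a + d *\<^sub>C a"
    and scaleC_scaleC: "c *\<^sub>C d *\<^sub>C a = (c * d) *\<^sub>C a"
    and scaleC_of_real: "complex_of_real r *\<^sub>C a = r *\<^sub>R a"
    and mult_scaleC_left: "(c *\<^sub>C a) * b = c *\<^sub>C (a * b)"
    and mult_scaleC_right: "a * (c *\<^sub>C b) = c *\<^sub>C (a * b)"
    and norm_scaleC: "norm (c *\<^sub>C a) = cmod c * norm a"
    and star_add: "star (a + b) = star a + star b"
    and star_scaleC: "star (c *\<^sub>C a) = cnj c *\<^sub>C star a"
    and star_mult: "star (a * b) = star b * star a"
    and star_star: "star (star a) = a"
    and cstar_identity: "norm (star a * a) = (norm a)\<^sup>2"

definition complex_linear ::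
    "('a::unital_cstar_algebra \<Rightarrow> complex) \<Rightarrow> bool" where
  "complex_linear \<omega> \<longleftrightarrow>
     (\<forall>a b. \<omega> (a + b) = \<omega> a + \<omega> b) \<and> (\<forall>c a. \<omega> (c *\<^sub>C a) = c * \<omega> a)"

text \<open>A state is a positive linear functional of norm one.\<close>

definition cstar_state :: "('a::unital_cstar_algebra \<Rightarrow> complex) \<Rightarrow> bool" where
  "cstar_state \<omega> \<longleftrightarrow>
     complex_linear \<omega> \<and>
     (\<forall>a. \<omega> (star a * a) \<in> \<real> \<and> 0 \<le> Re (\<omega> (star a * a))) \<and>
     bounded_linear \<omega> \<and> onorm \<omega> = 1"

definition tracial :: "('a::unital_cstar_algebra \<Rightarrow> complex) \<Rightarrow> bool" where
  "tracial \<omega> \<longleftrightarrow> (\<forall>a b. \<omega> (a * b) = \<omega> (b * a))"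

definition star_automorphism ::
    "('a::unital_cstar_algebra \<Rightarrow> 'a) \<Rightarrow> bool" where
  "star_automorphism f \<longleftrightarrow>
     bij f \<and>
     (\<forall>a b. f (a + b) = f a + f b) \<and>
     (\<forall>c a. f (c *\<^sub>C a) = c *\<^sub>C f a) \<and>
     (\<forall>a b. f (a * b) = f a * f b) \<and>
     (\<forall>a. f (star a) = star (f a))"

definition commutator :: "'a::ring \<Rightarrow> 'a \<Rightarrow> 'a" where
  "commutator a b = a * b - b * a"


section \<open>Measure groups and Foelner nets\<close>

text \<open>
  Groups are written additively, so that the library classes for topological groups apply:
  \<open>gh\<close>, \<open>g\<^sup>-\<^sup>1\<close> and \<open>e\<close> become \<open>g + h\<close>, \<open>- g\<close> and \<open>0\<close>; accordingly \<open>right_translate V g\<close> is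
  \<open>Vg\<close> and \<open>difference_set V\<close> is \<open>V\<^sup>-\<^sup>1V\<close>.
\<close>

definition right_translate :: "'g::group_add set \<Rightarrow> 'g \<Rightarrow> 'g set" where
  "right_translate V g = (\<lambda>v. v + g) ` V"

definition difference_set :: "'g::group_add set \<Rightarrow> 'g set" where
  "difference_set V = {- v + w | v w. v \<in> V \<and> w \<in> V}"

locale right_invariant_measure_group =
  fixes \<mu> :: "'g::group_add measure"
  assumes space_eq_UNIV: "space \<mu> = UNIV"
    and right_translate_sets:
      "V \<in> sets \<mu> \<Longrightarrow> right_translate V g \<in> sets \<mu>"
    and emeasure_right_translate:
      "V \<in> sets \<mu> \<Longrightarrow> emeasure \<mu> (right_translate V g) = emeasure \<mu> V"

text \<open>
  A net is given by its map \<open>\<Lambda>\<close> on the index type and by the proper filter \<open>F\<close> generated by the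
  tails of the index set; sequences have \<open>F = sequentially\<close>.
\<close>

definition folner ::
    "'g::group_add measure \<Rightarrow> ('i \<Rightarrow> 'g set) \<Rightarrow> 'i filter \<Rightarrow> bool" where
  "folner \<mu> \<Lambda> F \<longleftrightarrow>
     F \<noteq> bot \<and>
     (\<forall>\<^sub>F \<alpha> in F. \<Lambda> \<alpha> \<in> sets \<mu>) \<and>
     (\<forall>\<^sub>F \<alpha> in F. 0 < emeasure \<mu> (\<Lambda> \<alpha>) \<and> emeasure \<mu> (\<Lambda> \<alpha>) < \<infinity>) \<and>
     (\<forall>g. ((\<lambda>\<alpha>. emeasure \<mu> (sym_diff (\<Lambda> \<alpha>) (right_translate (\<Lambda> \<alpha>) g))
                 / emeasure \<mu> (\<Lambda> \<alpha>)) \<longlongrightarrow> 0) F)"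

definition uniform_folner ::
    "'g::group_add measure \<Rightarrow> ('i \<Rightarrow> 'g set) \<Rightarrow> 'i filter \<Rightarrow> bool" where
  "uniform_folner \<mu> \<Lambda> F \<longleftrightarrow>
     folner \<mu> \<Lambda> F \<and>
     (\<forall>\<^sub>F \<beta> in F.
       ((\<lambda>\<alpha>. (SUP g\<in>\<Lambda> \<beta>. emeasure \<mu> (sym_diff (\<Lambda> \<alpha>) (right_translate (\<Lambda> \<alpha>) g)))
             / emeasure \<mu> (\<Lambda> \<alpha>)) \<longlongrightarrow> 0) F)"

definition tempelman ::
    "'g::group_add measure \<Rightarrow> ('i \<Rightarrow> 'g set) \<Rightarrow> 'i filter \<Rightarrow> bool" where
  "tempelman \<mu> \<Lambda> F \<longleftrightarrow>
     (\<exists>c::real. c > 0 \<and>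
       (\<forall>\<^sub>F \<alpha> in F. difference_set (\<Lambda> \<alpha>) \<in> sets \<mu> \<and>
          emeasure \<mu> (difference_set (\<Lambda> \<alpha>)) \<le> ennreal c * emeasure \<mu> (\<Lambda> \<alpha>)))"


section \<open>C*-dynamical systems\<close>

text \<open>
  Whether a net of sets is Foelner, and the limit in the definition of weak mixing, depend only on
  the image in \<^typ>\<open>'g set filter\<close> of the tail filter of the net. Conversely every proper filter
  on sets arises in this way from a net. So ``there is a Foelner net'' is expressed by
  quantifying over filters on sets, with the identity map as the net.
\<close>

locale cstar_dynamical_system = right_invariant_measure_group \<mu>
  for \<mu> :: "'g::ab_group_add measure" +
  fixes \<omega> :: "'a::unital_cstar_algebra \<Rightarrow> complex"
    and \<tau> :: "'g \<Rightarrow> 'a \<Rightarrow> 'a"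
  assumes folner_exists: "\<exists>F. folner \<mu> (\<lambda>\<Lambda>. \<Lambda>) F"
    and measurable_inverse: "uminus \<in> measurable \<mu> \<mu>"
    and emeasure_inverse: "V \<in> sets \<mu> \<Longrightarrow> emeasure \<mu> (uminus ` V) = emeasure \<mu> V"
    and state: "cstar_state \<omega>"
    and automorphism: "star_automorphism (\<tau> g)"
    and action_zero: "\<tau> 0 = id"
    and action_add: "\<tau> g \<circ> \<tau> h = \<tau> (g + h)"
    and invariant: "\<omega> \<circ> \<tau> g = \<omega>"
    and measurable_correlation: "(\<lambda>g. \<omega> (a * \<tau> g b)) \<in> borel_measurable \<mu>"

definition weakly_mixing ::
    "'g::ab_group_add measure \<Rightarrow> ('a::unital_cstar_algebra \<Rightarrow> complex)
      \<Rightarrow> ('g \<Rightarrow> 'a \<Rightarrow> 'a) \<Rightarrow> bool" where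
  "weakly_mixing \<mu> \<omega> \<tau> \<longleftrightarrow>
     (\<exists>F. folner \<mu> (\<lambda>\<Lambda>. \<Lambda>) F \<and>
       (\<forall>a b. ((\<lambda>\<Lambda>. (LINT g:\<Lambda>|\<mu>. cmod (\<omega> (a * \<tau> g b) - \<omega> a * \<omega> b)) / measure \<mu> \<Lambda>)
                \<longlongrightarrow> 0) F))"

definition asymptotically_abelian ::
    "'g::ab_group_add measure \<Rightarrow> ('g \<Rightarrow> 'a \<Rightarrow> 'a::unital_cstar_algebra)
      \<Rightarrow> ('i \<Rightarrow> 'g set) \<Rightarrow> 'i filter \<Rightarrow> bool" where
  "asymptotically_abelian \<mu> \<tau> \<Lambda> F \<longleftrightarrow>
     (\<forall>a b. (\<lambda>g. norm (commutator a (\<tau> g b))) \<in> borel_measurable \<mu> \<and>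
       ((\<lambda>\<alpha>. (LINT g:\<Lambda> \<alpha>|\<mu>. norm (commutator a (\<tau> g b))) / measure \<mu> (\<Lambda> \<alpha>))
         \<longlongrightarrow> 0) F)"

definition uniformly_asymptotically_abelian ::
    "'g::ab_group_add measure \<Rightarrow> ('g \<Rightarrow> 'a \<Rightarrow> 'a::unital_cstar_algebra)
      \<Rightarrow> ('i \<Rightarrow> 'g set) \<Rightarrow> 'i filter \<Rightarrow> bool" where
  "uniformly_asymptotically_abelian \<mu> \<tau> \<Lambda> F \<longleftrightarrow>
     (\<forall>a b. (\<lambda>g. norm (commutator a (\<tau> g b))) \<in> borel_measurable \<mu> \<and>
       ((\<lambda>\<alpha>. SUP h. (LINT g:right_translate (\<Lambda> \<alpha>) h|\<mu>. norm (commutator a (\<tau> g b)))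
                     / measure \<mu> (\<Lambda> \<alpha>))
         \<longlongrightarrow> 0) F)"

text \<open>
  The counting measure is taken on the given sigma-algebra, which need not be the power set
  (the topology of the group is not assumed to be Hausdorff).
\<close>

definition is_counting_measure :: "'g measure \<Rightarrow> bool" where
  "is_counting_measure \<mu> \<longleftrightarrow>
     (\<forall>V\<in>sets \<mu>. emeasure \<mu> V = emeasure (count_space UNIV) V)"

end

theory Submission
  imports Defs
begin

text \<open>
  Weak mixing yields, for given \<open>a\<close>, \<open>b\<close>, \<open>N\<close> and \<open>\<delta>\<close>, points \<open>s\<^sub>1, \<dots>, s\<^sub>N\<close> of the group whose
  differences \<open>s = s\<^sub>j - s\<^sub>i\<close> all satisfy \<open>\<omega> (a\<^sup>* \<tau>\<^sub>s a) \<approx> \<bar>\<omega> a\<bar>\<^sup>2\<close> up to \<open>\<delta>\<close>, and likewise for \<open>b\<close>: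
  each new point only has to avoid a set of density zero along the given Foelner net. The average of
  a bounded function over a far out Foelner set changes little, uniformly over the translates of
  that set, when the function \<open>f\<close> is replaced by \<open>(f (g + s\<^sub>1) + \<dots> + f (g + s\<^sub>N)) / N\<close>, and the latter
  is small by the Cauchy-Schwarz inequality for \<open>\<omega>\<close> and the near-orthogonality of the translates of
  \<open>a - \<omega> a\<close>. This first shows that \<open>\<bar>\<omega> (\<tau>\<^sub>h a * b) - \<omega> a * \<omega> b\<bar>\<close> averages to zero over every Foelner
  sequence. In the double average, the inner average over \<open>g\<close> is smoothed in the same way, with
  points independent of \<open>h\<close>, applied to \<open>x\<^sub>h = \<tau>\<^sub>h a * b - \<omega> a * \<omega> b\<close>. By the trace property, the
  correlations \<open>\<omega> (x\<^sub>h\<^sup>* \<tau>\<^sub>s x\<^sub>h)\<close> average over \<open>h\<close> to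
  \<open>\<omega> (a\<^sup>* \<tau>\<^sub>s a) * \<omega> (b\<^sup>* \<tau>\<^sub>s b) - \<bar>\<omega> a * \<omega> b\<bar>\<^sup>2\<close>, which is small for the chosen \<open>s\<close>.
\<close>

section \<open>States\<close>

lemma star_zero [simp]: "star (0::'a::unital_cstar_algebra) = 0"
  by (metis add_cancel_right_right star_add)

lemma star_one [simp]: "star (1::'a::unital_cstar_algebra) = 1"
  by (metis mult.right_neutral mult.left_neutral star_mult star_star)

lemma star_diff: "star (a - b) = star a - star (b::'a::unital_cstar_algebra)"
  by (metis add_diff_cancel_right' diff_add_cancel star_add)

lemma star_sum: "star (sum f I) = (\<Sum>i\<in>I. star (f i :: 'a::unital_cstar_algebra))"
  by (induction I rule: infinite_finite_induct) (auto simp: star_add)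

section \<open>Positivity, the Cauchy-Schwarz inequality and normalisation of states\<close>

locale cstar_state_space =
  fixes \<omega> :: "'a::unital_cstar_algebra \<Rightarrow> complex"
  assumes is_state: "cstar_state \<omega>"
begin

lemma state_add: "\<omega> (a + b) = \<omega> a + \<omega> b"
  and state_scaleC: "\<omega> (c *\<^sub>C a) = c * \<omega> a"
  using is_state unfolding cstar_state_def complex_linear_def by auto

lemma state_bounded_linear: "bounded_linear \<omega>"
  using is_state unfolding cstar_state_def by auto

lemma state_diff: "\<omega> (a - b) = \<omega> a - \<omega> b"
  by (metis add_diff_cancel_right' diff_add_cancel state_add)

lemma state_sum: "\<omega> (sum f I) = (\<Sum>i\<in>I. \<omega> (f i))"
  using bounded_linear.linear[OF state_bounded_linear] by (rule linear_sum)

lemma cmod_state_le: "cmod (\<omega> a) \<le> norm a"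
  using onorm[OF state_bounded_linear, of a] is_state unfolding cstar_state_def by simp

text \<open>This is the square of the GNS seminorm of \<open>\<omega>\<close>.\<close>

definition seminorm_sq :: "'a \<Rightarrow> real" where
  "seminorm_sq a = Re (\<omega> (star a * a))"

lemma seminorm_sq_nonneg [simp]: "0 \<le> seminorm_sq a"
  using is_state unfolding cstar_state_def seminorm_sq_def by auto

lemma state_star_mult_self: "\<omega> (star a * a) = complex_of_real (seminorm_sq a)"
  using is_state unfolding cstar_state_def seminorm_sq_def
  by (simp add: of_real_Re)

lemma seminorm_sq_le: "seminorm_sq a \<le> (norm a)\<^sup>2"
  using cmod_state_le[of "star a * a"] complex_Re_le_cmod[of "\<omega> (star a * a)"]
  unfolding cstar_identity seminorm_sq_def by linarith

text \<open>Positivity makes \<open>\<omega>\<close> real on \<open>star (a + 1) * (a + 1)\<close>,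
  so the imaginary parts of \<open>\<omega> (star a)\<close> and \<open>\<omega> a\<close> cancel.
  The same fact for \<open>\<i> *\<^sub>C a\<close> settles the real parts.\<close>

lemma state_star: "\<omega> (star a) = cnj (\<omega> a)"
proof -
  have *: "Im (\<omega> (star a)) + Im (\<omega> a) = 0" for a
  proof -
    have "\<omega> (star (a + 1) * (a + 1)) = \<omega> (star a * a) + \<omega> (star a) + \<omega> a + \<omega> (star 1 * 1)"
      by (simp add: state_add star_add algebra_simps)
    then have "Im (\<omega> (star a) + \<omega> a) = 0"
      by (simp only: state_star_mult_self) (simp add: complex_eq_iff)
    then show ?thesis by simp
  qed
  from *[of "\<i> *\<^sub>C a"] have "Re (\<omega> (star a)) = Re (\<omega> a)"
    by (simp add: star_scaleC state_scaleC)
  with *[of a] show ?thesis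
    by (simp add: complex_eq_iff)
qed

lemma seminorm_sq_scaleC_add:
  "seminorm_sq (c *\<^sub>C a + b) =
     (cmod c)\<^sup>2 * seminorm_sq a + 2 * Re (cnj c * \<omega> (star a * b)) + seminorm_sq b"
proof -
  have "\<omega> (star b * a) = cnj (\<omega> (star a * b))"
    using state_star[of "star a * b"] by (simp add: star_mult star_star)
  then have "\<omega> (star (c *\<^sub>C a + b) * (c *\<^sub>C a + b)) =
     (cnj c * c) * \<omega> (star a * a) + cnj c * \<omega> (star a * b) + c * cnj (\<omega> (star a * b))
       + \<omega> (star b * b)"
    by (simp add: star_add star_scaleC algebra_simps mult_scaleC_left mult_scaleC_right
        state_add state_scaleC)
  then show ?thesis
    unfolding seminorm_sq_def[of "c *\<^sub>C a + b"]
    by (simp add: state_star_mult_self cmod_def power2_eq_square algebra_simps)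
qed

text \<open>Adding to \<open>b\<close> a multiple of \<open>a\<close> in the direction of
  \<open>w\<close> gives a real quadratic in \<open>t\<close> that is never negative.\<close>

lemma cauchy_schwarz_sq: "(cmod (\<omega> (star a * b)))\<^sup>2 \<le> seminorm_sq a * seminorm_sq b"
proof -
  define w where "w = \<omega> (star a * b)"
  have quad: "0 \<le> t\<^sup>2 * (cmod w)\<^sup>2 * seminorm_sq a - 2 * t * (cmod w)\<^sup>2 + seminorm_sq b" for t
  proof -
    have "0 \<le> seminorm_sq ((- of_real t * w) *\<^sub>C a + b)" by simp
    also have "\<dots> = t\<^sup>2 * (cmod w)\<^sup>2 * seminorm_sq a - 2 * t * (cmod w)\<^sup>2 + seminorm_sq b"
      unfolding seminorm_sq_scaleC_add w_def[symmetric]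
      by (simp add: norm_mult power_mult_distrib cmod_power2 algebra_simps)
        (simp add: power2_eq_square)
    finally show ?thesis .
  qed
  show ?thesis
  \<comment> \<open>If the leading coefficient vanishes through \<open>seminorm_sq a = 0\<close>,
    the quadratic is affine, and a large \<open>t\<close> makes it negative unless
    \<open>w = 0\<close>. Otherwise \<open>t = 1 / seminorm_sq a\<close> is the minimum
    point.\<close>
  proof (cases "seminorm_sq a = 0")
    case True
    show ?thesis
    proof (rule ccontr)
      assume "\<not> ?thesis"
      then have "0 < (cmod w)\<^sup>2" using True by (simp add: w_def)
      with quad[of "(seminorm_sq b + 1) / (cmod w)\<^sup>2"] True
      have "2 * (seminorm_sq b + 1) \<le> seminorm_sq b" by (simp add: \<open>0 < (cmod w)\<^sup>2\<close> less_imp_neq)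
      then have "seminorm_sq b \<le> - 2" by simp
      then show False using seminorm_sq_nonneg[of b] by simp
    qed
  next
    case False
    then have p: "0 < seminorm_sq a" using seminorm_sq_nonneg[of a] by linarith
    from quad[of "1 / seminorm_sq a"] p show ?thesis
      by (simp add: w_def[symmetric] field_simps power2_eq_square)
  qed
qed

lemma cauchy_schwarz:
  "cmod (\<omega> (star a * b)) \<le> sqrt (seminorm_sq a) * sqrt (seminorm_sq b)"
  using cauchy_schwarz_sq[of a b] by (simp add: real_le_rsqrt real_sqrt_mult[symmetric])

text \<open>Cauchy-Schwarz against 1 bounds the norm of \<open>\<omega>\<close> by the square root
  of \<open>\<omega> 1\<close>. Norm one therefore forces \<open>\<omega> 1\<close> up to 1, and
  \<open>seminorm_sq_le\<close> keeps it from exceeding 1.\<close>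

lemma state_one [simp]: "\<omega> 1 = 1"
proof -
  define u where "u = seminorm_sq 1"
  have u: "\<omega> 1 = complex_of_real u"
    using state_star_mult_self[of 1] by (simp add: u_def)
  have "u \<le> 1" using seminorm_sq_le[of 1] by (simp add: u_def)
  have "cmod (\<omega> a) \<le> sqrt u * norm a" for a
  proof -
    have "cmod (\<omega> a) \<le> sqrt u * sqrt (seminorm_sq a)"
      using cauchy_schwarz[of 1 a] by (simp add: u_def)
    also have "\<dots> \<le> sqrt u * sqrt ((norm a)\<^sup>2)"
      by (intro mult_left_mono real_sqrt_le_mono seminorm_sq_le) (simp add: u_def)
    finally show ?thesis by simp
  qed
  then have "onorm \<omega> \<le> sqrt u"
    by (intro onorm_bound) (auto simp: u_def)
  then have "1 \<le> sqrt u"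
    using is_state unfolding cstar_state_def by simp
  with \<open>u \<le> 1\<close> have "u = 1" by simp
  with u show ?thesis by simp
qed

end

section \<open>Averages over a measure group\<close>

definition average ::
    "'g measure \<Rightarrow> 'g set \<Rightarrow> ('g \<Rightarrow> 'b) \<Rightarrow> 'b::{banach, second_countable_topology}" where
  "average \<mu> V f = (LINT g:V|\<mu>. f g) /\<^sub>R measure \<mu> V"

text \<open>\<open>measure\<close> is 0 on non-measurable sets and on sets of infinite measure.
  Positivity thus carries measurability and finiteness in one hypothesis, the form used from here
  on.\<close>

lemma measure_pos_imp:
  assumes "0 < measure \<mu> V"
  shows "V \<in> sets \<mu>" "emeasure \<mu> V < \<infinity>"
proof -
  show "V \<in> sets \<mu>" using assms measure_notin_sets by force
  show "emeasure \<mu> V < \<infinity>" using assms by (simp add: measure_def enn2real_positive_iff)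
qed

text \<open>This covers non-integrable \<open>f\<close> too, since its Bochner integral is 0 by
  default.\<close>

lemma norm_integral_le:
  fixes f :: "'g \<Rightarrow> 'b::{banach, second_countable_topology}"
  assumes "integrable \<mu> f'" "\<And>g. norm (f g) \<le> f' g"
  shows "norm (integral\<^sup>L \<mu> f) \<le> integral\<^sup>L \<mu> f'"
proof -
  have "norm (integral\<^sup>L \<mu> f) \<le> (\<integral>g. norm (f g) \<partial>\<mu>)" by (rule integral_norm_bound)
  also have "\<dots> \<le> integral\<^sup>L \<mu> f'"
    using assms by (intro integral_mono') (auto intro: order_trans[OF norm_ge_zero])
  finally show ?thesis .
qed

lemma bounded_set_integrable:
  fixes f :: "'g \<Rightarrow> 'b::{banach, second_countable_topology}"
  assumes "0 < measure \<mu> V" "f \<in> borel_measurable \<mu>" "\<And>g. norm (f g) \<le> C"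
  shows "set_integrable \<mu> V f"
  unfolding set_integrable_def
  using assms measure_pos_imp[OF assms(1)]
  by (intro integrableI_bounded_set_indicator[where B = C]) auto

lemma average_const:
  assumes "0 < measure \<mu> V"
  shows "average \<mu> V (\<lambda>_. c) = c"
  using assms measure_pos_imp[OF assms] unfolding average_def set_lebesgue_integral_def
  by simp

lemma average_zero: "average \<mu> V (\<lambda>_. 0) = 0"
  by (simp add: average_def set_lebesgue_integral_def)

lemma set_integrable_sum:
  assumes "\<And>i. i \<in> I \<Longrightarrow> set_integrable \<mu> V (f i)"
  shows "set_integrable \<mu> V (\<lambda>g. \<Sum>i\<in>I. f i g)"
  using assms unfolding set_integrable_def by (simp add: scaleR_sum_right)

lemma average_add:
  "set_integrable \<mu> V f \<Longrightarrow> set_integrable \<mu> V f' \<Longrightarrow>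
    average \<mu> V (\<lambda>g. f g + f' g) = average \<mu> V f + average \<mu> V f'"
  by (simp add: average_def set_integral_add scaleR_add_right)

lemma average_diff:
  "set_integrable \<mu> V f \<Longrightarrow> set_integrable \<mu> V f' \<Longrightarrow>
    average \<mu> V (\<lambda>g. f g - f' g) = average \<mu> V f - average \<mu> V f'"
  by (simp add: average_def set_integral_diff scaleR_diff_right)

lemma average_cmult:
  fixes c :: "'b::{real_normed_field, banach, second_countable_topology}"
  shows "average \<mu> V (\<lambda>g. c * f g) = c * average \<mu> V f"
  by (simp add: average_def )

lemma average_sum:
  assumes "finite I" "\<And>i. i \<in> I \<Longrightarrow> set_integrable \<mu> V (f i)"
  shows "average \<mu> V (\<lambda>g. \<Sum>i\<in>I. f i g) = (\<Sum>i\<in>I. average \<mu> V (f i))"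
  using assms by (induction I) (auto simp: average_add set_integrable_sum average_zero)

lemma average_mono:
  fixes f f' :: "'g \<Rightarrow> real"
  assumes "set_integrable \<mu> V f" "set_integrable \<mu> V f'" "\<And>g. g \<in> V \<Longrightarrow> f g \<le> f' g"
  shows "average \<mu> V f \<le> average \<mu> V f'"
  unfolding average_def using assms
  by (auto intro!: mult_left_mono set_integral_mono simp: divide_right_mono)

lemma norm_average_le:
  assumes "set_integrable \<mu> V f'" "\<And>g. norm (f g) \<le> f' g"
  shows "norm (average \<mu> V f) \<le> average \<mu> V f'"
proof -
  have "norm (LINT g:V|\<mu>. f g) \<le> (LINT g:V|\<mu>. f' g)"
    using assms unfolding set_lebesgue_integral_def set_integrable_def
    by (intro norm_integral_le) (auto simp: indicator_def)
  then show ?thesis unfolding average_def by (simp add: mult_left_mono)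
qed

section \<open>Translation invariance and averages over Foelner sets\<close>

locale abelian_measure_group = right_invariant_measure_group \<mu>
  for \<mu> :: "'g::ab_group_add measure"
begin

definition boundary_ratio :: "'g set \<Rightarrow> 'g \<Rightarrow> real" where
  "boundary_ratio V s = measure \<mu> (sym_diff V (right_translate V s)) / measure \<mu> V"

lemma measure_right_translate: "measure \<mu> (right_translate V t) = measure \<mu> V"
proof (cases "V \<in> sets \<mu>")
  case True
  then show ?thesis using emeasure_right_translate[of V t] by (simp add: measure_def)
next
  case False
  \<comment> \<open>Translating back shows that a translate of a non-measurable set is
    non-measurable, so both measures take the default value 0.\<close>
  have "right_translate (right_translate V t) (-t) = V"
    by (auto simp: right_translate_def image_image)
  with False have "right_translate V t \<notin> sets \<mu>"
    using right_translate_sets[of "right_translate V t" "-t"] by auto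
  with False show ?thesis by (simp add: measure_notin_sets)
qed

text \<open>Commutativity moves the shift by \<open>t\<close> past the shift by \<open>s\<close>, so
  the whole symmetric difference is shifted by \<open>t\<close>. This is the source of all bounds
  that are uniform over translates of a Foelner set.\<close>

lemma boundary_ratio_right_translate: "boundary_ratio (right_translate V t) s = boundary_ratio V s"
proof -
  have "sym_diff (right_translate V t) (right_translate (right_translate V t) s) =
      right_translate (sym_diff V (right_translate V s)) t"
    unfolding right_translate_def
    by (simp add: image_Un image_set_diff inj_def image_image ac_simps)
  then show ?thesis by (simp add: boundary_ratio_def measure_right_translate)
qed

lemma vimage_translate: "(\<lambda>g. g + s) -` A = right_translate A (- s)"
  by (force simp: right_translate_def image_iff)

lemma measurable_translate [measurable]: "(\<lambda>g. g + s) \<in> measurable \<mu> \<mu>"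
  by (rule measurableI) (auto simp: space_eq_UNIV vimage_translate right_translate_sets)

text \<open>Invariance as a push-forward identity, the form in which it yields the change of
  variables for integrals.\<close>

lemma distr_translate: "distr \<mu> \<mu> (\<lambda>g. g + s) = \<mu>"
  by (rule measure_eqI)
    (auto simp: emeasure_distr space_eq_UNIV vimage_translate emeasure_right_translate)

lemma set_integral_translate:
  fixes f :: "'g \<Rightarrow> 'b::{banach, second_countable_topology}"
  assumes "V \<in> sets \<mu>" "f \<in> borel_measurable \<mu>"
  shows "(LINT g:right_translate V s|\<mu>. f g) = (LINT g:V|\<mu>. f (g + s))"
proof -
  have [measurable]: "right_translate V s \<in> sets \<mu>" using assms right_translate_sets by auto
  note assms(2)[measurable]
  have "(LINT g:right_translate V s|\<mu>. f g) =
      (\<integral>g. indicator (right_translate V s) g *\<^sub>R f g \<partial>distr \<mu> \<mu> (\<lambda>g. g + s))"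
    by (simp add: distr_translate set_lebesgue_integral_def)
  also have "\<dots> = (\<integral>g. indicator (right_translate V s) (g + s) *\<^sub>R f (g + s) \<partial>\<mu>)"
    by (rule integral_distr) auto
  also have "\<dots> = (LINT g:V|\<mu>. f (g + s))"
    unfolding set_lebesgue_integral_def
    by (intro Bochner_Integration.integral_cong) (auto simp: indicator_def right_translate_def)
  finally show ?thesis .
qed

text \<open>Averaging the translated function over \<open>V\<close> is averaging \<open>f\<close>
  over \<open>right_translate V s\<close>. The two integrals of \<open>f\<close> differ only on the
  symmetric difference, where the integrand is at most \<open>C\<close>.\<close>

lemma average_translate_le:
  fixes f :: "'g \<Rightarrow> 'b::{banach, second_countable_topology}"
  assumes V: "0 < measure \<mu> V" and f: "f \<in> borel_measurable \<mu>" "\<And>g. norm (f g) \<le> C"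
  shows "norm (average \<mu> V f - average \<mu> V (\<lambda>g. f (g + s))) \<le> C * boundary_ratio V s"
proof -
  let ?W = "right_translate V s"
  have W: "0 < measure \<mu> ?W" using V by (simp add: measure_right_translate)
  note sets = measure_pos_imp[OF V] measure_pos_imp[OF W]
  have iV: "set_integrable \<mu> V f" and iW: "set_integrable \<mu> ?W f"
    using bounded_set_integrable V W f by blast+
  have "emeasure \<mu> (sym_diff V ?W) \<le> emeasure \<mu> (V \<union> ?W)"
    using sets by (intro emeasure_mono) auto
  also have "\<dots> \<le> emeasure \<mu> V + emeasure \<mu> ?W"
    using sets by (intro emeasure_subadditive) auto
  also have "\<dots> < \<infinity>" using sets by (simp add: less_top)
  finally have fin: "emeasure \<mu> (sym_diff V ?W) < \<infinity>" .
  have "(LINT g:V|\<mu>. f g) - (LINT g:?W|\<mu>. f g) =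
      (\<integral>g. indicator V g *\<^sub>R f g - indicator ?W g *\<^sub>R f g \<partial>\<mu>)"
    using iV iW unfolding set_lebesgue_integral_def set_integrable_def by simp
  also have "norm \<dots> \<le> (\<integral>g. C * indicator (sym_diff V ?W) g \<partial>\<mu>)"
  proof (rule norm_integral_le)
    show "integrable \<mu> (\<lambda>g. C * indicator (sym_diff V ?W) g)"
      using fin sets by (intro integrable_mult_right integrable_real_indicator) auto
    show "norm (indicator V g *\<^sub>R f g - indicator ?W g *\<^sub>R f g) \<le> C * indicator (sym_diff V ?W) g" for g
      using f(2)[of g] by (auto simp: indicator_def)
  qed
  also have "\<dots> = C * measure \<mu> (sym_diff V ?W)"
    using sets by (simp add: space_eq_UNIV)
  finally have *: "norm ((LINT g:V|\<mu>. f g) - (LINT g:?W|\<mu>. f g)) \<le> C * measure \<mu> (sym_diff V ?W)" .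
  have "average \<mu> V f - average \<mu> V (\<lambda>g. f (g + s)) =
      ((LINT g:V|\<mu>. f g) - (LINT g:?W|\<mu>. f g)) /\<^sub>R measure \<mu> V"
    using set_integral_translate[OF sets(1) f(1)] by (simp add: average_def scaleR_diff_right)
  also have "norm \<dots> = norm ((LINT g:V|\<mu>. f g) - (LINT g:?W|\<mu>. f g)) / measure \<mu> V"
    by (simp add: divide_inverse mult.commute)
  also have "\<dots> \<le> C * measure \<mu> (sym_diff V ?W) / measure \<mu> V"
    by (intro divide_right_mono *) simp
  finally show ?thesis by (simp add: boundary_ratio_def)
qed

text \<open>Write \<open>N\<close> times the average as the average of the sum of translates plus
  \<open>N\<close> translation errors. The former is at most \<open>N * D\<close> by the pointwise
  bound, each of the latter at most \<open>C * r\<close>.\<close>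

lemma norm_average_le_boundary_ratio:
  fixes f :: "'g \<Rightarrow> 'b::{banach, second_countable_topology}"
  assumes V: "0 < measure \<mu> V" and f: "f \<in> borel_measurable \<mu>" "\<And>g. norm (f g) \<le> C"
    and "0 < N" and D: "\<And>g. norm (\<Sum>i<N. f (g + s i)) \<le> real N * D"
    and r: "\<And>i. i < N \<Longrightarrow> boundary_ratio V (s i) \<le> r"
  shows "norm (average \<mu> V f) \<le> D + C * r"
proof -
  note f(1)[measurable]
  have "0 \<le> C" using f(2) norm_ge_zero order_trans by blast
  have int: "set_integrable \<mu> V (\<lambda>g. f (g + s i))" for i
    by (rule bounded_set_integrable[OF V _ f(2)]) simp
  have "real N *\<^sub>R average \<mu> V f =
      (\<Sum>i<N. average \<mu> V f - average \<mu> V (\<lambda>g. f (g + s i))) + average \<mu> V (\<lambda>g. \<Sum>i<N. f (g + s i))"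
    by (simp add: average_sum int sum_subtractf sum_constant_scaleR)
  also have "norm \<dots> \<le> (\<Sum>i<N. norm (average \<mu> V f - average \<mu> V (\<lambda>g. f (g + s i))))
      + norm (average \<mu> V (\<lambda>g. \<Sum>i<N. f (g + s i)))"
    by (intro norm_triangle_le add_mono norm_sum order_refl)
  also have "\<dots> \<le> (\<Sum>i<N. C * r) + real N * D"
  proof (intro add_mono sum_mono)
    fix i assume "i \<in> {..<N}"
    then show "norm (average \<mu> V f - average \<mu> V (\<lambda>g. f (g + s i))) \<le> C * r"
      using average_translate_le[OF V f] r[of i] mult_left_mono[OF _ \<open>0 \<le> C\<close>]
      by (meson lessThan_iff order_trans)
  next
    show "norm (average \<mu> V (\<lambda>g. \<Sum>i<N. f (g + s i))) \<le> real N * D"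
      using norm_average_le[of \<mu> V "\<lambda>_. real N * D", OF _ D] average_const[OF V, of "real N * D"]
        bounded_set_integrable[OF V, of "\<lambda>_. real N * D" "\<bar>real N * D\<bar>"]
      by simp
  qed
  finally have "real N * norm (average \<mu> V f) \<le> real N * (D + C * r)"
    by (simp add: algebra_simps)
  then show ?thesis using \<open>0 < N\<close> by simp
qed

text \<open>The Foelner condition lives in \<open>ennreal\<close>. Far out in the net all measures
  involved are finite, so the limit passes to the reals.\<close>

lemma folner_boundary_ratio:
  assumes "folner \<mu> \<Lambda> F"
  shows "\<forall>\<^sub>F \<alpha> in F. 0 < measure \<mu> (\<Lambda> \<alpha>)"
    and "((\<lambda>\<alpha>. boundary_ratio (\<Lambda> \<alpha>) s) \<longlongrightarrow> 0) F"
proof -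
  have *: "\<forall>\<^sub>F \<alpha> in F. 0 < emeasure \<mu> (\<Lambda> \<alpha>) \<and> emeasure \<mu> (\<Lambda> \<alpha>) < \<infinity>"
    and **: "((\<lambda>\<alpha>. emeasure \<mu> (sym_diff (\<Lambda> \<alpha>) (right_translate (\<Lambda> \<alpha>) s)) / emeasure \<mu> (\<Lambda> \<alpha>)) \<longlongrightarrow> 0) F"
    using assms unfolding folner_def by auto
  show pos: "\<forall>\<^sub>F \<alpha> in F. 0 < measure \<mu> (\<Lambda> \<alpha>)"
    using * by eventually_elim (simp add: measure_def enn2real_positive_iff)
  have "((\<lambda>\<alpha>. enn2real (emeasure \<mu> (sym_diff (\<Lambda> \<alpha>) (right_translate (\<Lambda> \<alpha>) s)) / emeasure \<mu> (\<Lambda> \<alpha>)))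
      \<longlongrightarrow> 0) F"
    by (rule tendsto_enn2real) (use ** in auto)
  moreover have "\<forall>\<^sub>F \<alpha> in F.
      enn2real (emeasure \<mu> (sym_diff (\<Lambda> \<alpha>) (right_translate (\<Lambda> \<alpha>) s)) / emeasure \<mu> (\<Lambda> \<alpha>))
      = boundary_ratio (\<Lambda> \<alpha>) s"
    using pos
  proof eventually_elim
    case (elim \<alpha>)
    let ?W = "right_translate (\<Lambda> \<alpha>) s"
    have W: "0 < measure \<mu> ?W" using elim by (simp add: measure_right_translate)
    note sets = measure_pos_imp[OF elim] measure_pos_imp[OF W]
    have "emeasure \<mu> (sym_diff (\<Lambda> \<alpha>) ?W) \<le> emeasure \<mu> (\<Lambda> \<alpha> \<union> ?W)"
      using sets by (intro emeasure_mono) auto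
    also have "\<dots> \<le> emeasure \<mu> (\<Lambda> \<alpha>) + emeasure \<mu> ?W"
      using sets by (intro emeasure_subadditive) auto
    also have "\<dots> < \<infinity>" using sets by (simp add: less_top)
    finally have "emeasure \<mu> (sym_diff (\<Lambda> \<alpha>) ?W) = ennreal (measure \<mu> (sym_diff (\<Lambda> \<alpha>) ?W))"
      by (simp add: emeasure_eq_ennreal_measure)
    moreover have "emeasure \<mu> (\<Lambda> \<alpha>) = ennreal (measure \<mu> (\<Lambda> \<alpha>))"
      using sets by (simp add: emeasure_eq_ennreal_measure)
    ultimately show ?case using elim
      by (simp add: divide_ennreal boundary_ratio_def)
  qed
  ultimately show "((\<lambda>\<alpha>. boundary_ratio (\<Lambda> \<alpha>) s) \<longlongrightarrow> 0) F"
    by (simp add: tendsto_cong)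
qed

text \<open>The order of quantifiers is the point: how far out one must go depends on
  \<open>N\<close>, \<open>s\<close> and \<open>r\<close> only, and not on the function, its bounds
  or the translate. This permits a family of functions indexed by a second group variable.\<close>

lemma eventually_norm_average_le:
  assumes "folner \<mu> \<Lambda> F" "0 < N" "0 < r"
  shows "\<forall>\<^sub>F \<alpha> in F. 0 < measure \<mu> (\<Lambda> \<alpha>) \<and>
    (\<forall>t (f::'g \<Rightarrow> 'b::{banach, second_countable_topology}) C D.
      f \<in> borel_measurable \<mu> \<longrightarrow> (\<forall>g. norm (f g) \<le> C) \<longrightarrow>
      (\<forall>g. norm (\<Sum>i<N. f (g + s i)) \<le> real N * D) \<longrightarrow>
      norm (average \<mu> (right_translate (\<Lambda> \<alpha>) t) f) \<le> D + C * r)"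
proof -
  have "\<forall>\<^sub>F \<alpha> in F. \<forall>i\<in>{..<N}. boundary_ratio (\<Lambda> \<alpha>) (s i) < r"
    by (intro eventually_ball_finite ballI order_tendstoD(2)[OF folner_boundary_ratio(2)] assms) auto
  with folner_boundary_ratio(1)[OF assms(1)] show ?thesis
  proof eventually_elim
    case (elim \<alpha>)
    then show ?case
      using assms(2)
      by (auto intro!: norm_average_le_boundary_ratio[where N = N and s = s]
          simp: measure_right_translate boundary_ratio_right_translate less_imp_le)
  qed
qed

text \<open>
  The points are chosen one after the other; the next one must lie where the sum of the translates
  of \<open>\<kappa>\<close> by the previous ones is small, and this sum has average tending to zero.
\<close>

lemma exists_separated_points:
  fixes \<kappa> :: "'g \<Rightarrow> real"
  assumes folner: "folner \<mu> \<Lambda> F"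
    and \<kappa>: "\<kappa> \<in> borel_measurable \<mu>" "\<And>g. 0 \<le> \<kappa> g" "\<And>g. \<kappa> g \<le> C" "\<And>g. \<kappa> (- g) = \<kappa> g"
    and lim: "((\<lambda>\<alpha>. average \<mu> (\<Lambda> \<alpha>) \<kappa>) \<longlongrightarrow> 0) F"
    and "0 < \<epsilon>"
  shows "\<exists>s::nat \<Rightarrow> 'g. \<forall>i<N. \<forall>j<N. i \<noteq> j \<longrightarrow> \<kappa> (s i - s j) < \<epsilon>"
proof (induction N)
  case 0
  then show ?case by simp
next
  case (Suc N)
  then obtain s :: "nat \<Rightarrow> 'g" where s: "\<forall>i<N. \<forall>j<N. i \<noteq> j \<longrightarrow> \<kappa> (s i - s j) < \<epsilon>" by blast
  note \<kappa>(1)[measurable]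
  have bound: "norm (\<kappa> g) \<le> C" for g using \<kappa>(2,3)[of g] by simp
  have pos: "\<forall>\<^sub>F \<alpha> in F. 0 < measure \<mu> (\<Lambda> \<alpha>)" using folner_boundary_ratio(1)[OF folner] .
  \<comment> \<open>A fixed translation changes the average by at most \<open>C\<close> times a
    boundary ratio, which tends to 0.\<close>
  have "((\<lambda>\<alpha>. average \<mu> (\<Lambda> \<alpha>) (\<lambda>g. \<kappa> (g + t))) \<longlongrightarrow> 0) F" for t
  proof -
    have "((\<lambda>\<alpha>. average \<mu> (\<Lambda> \<alpha>) \<kappa> - average \<mu> (\<Lambda> \<alpha>) (\<lambda>g. \<kappa> (g + t))) \<longlongrightarrow> 0) F"
    proof (rule Lim_null_comparison)
      show "\<forall>\<^sub>F \<alpha> in F. norm (average \<mu> (\<Lambda> \<alpha>) \<kappa> - average \<mu> (\<Lambda> \<alpha>) (\<lambda>g. \<kappa> (g + t)))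
          \<le> C * boundary_ratio (\<Lambda> \<alpha>) t"
        using pos by eventually_elim (rule average_translate_le[OF _ \<kappa>(1) bound])
      show "((\<lambda>\<alpha>. C * boundary_ratio (\<Lambda> \<alpha>) t) \<longlongrightarrow> 0) F"
        using tendsto_mult_right_zero[OF folner_boundary_ratio(2)[OF folner]] .
    qed
    from tendsto_diff[OF lim this] show ?thesis by simp
  qed
  then have "((\<lambda>\<alpha>. \<Sum>j<N. average \<mu> (\<Lambda> \<alpha>) (\<lambda>g. \<kappa> (g + - s j))) \<longlongrightarrow> 0) F"
    by (intro tendsto_null_sum)
  then have "\<forall>\<^sub>F \<alpha> in F. (\<Sum>j<N. average \<mu> (\<Lambda> \<alpha>) (\<lambda>g. \<kappa> (g + - s j))) < \<epsilon>"
    using \<open>0 < \<epsilon>\<close> by (rule order_tendstoD(2))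
  with pos have "\<forall>\<^sub>F \<alpha> in F. 0 < measure \<mu> (\<Lambda> \<alpha>) \<and>
      (\<Sum>j<N. average \<mu> (\<Lambda> \<alpha>) (\<lambda>g. \<kappa> (g + - s j))) < \<epsilon>"
    by eventually_elim simp
  then obtain \<alpha> where \<alpha>: "0 < measure \<mu> (\<Lambda> \<alpha>)"
      "(\<Sum>j<N. average \<mu> (\<Lambda> \<alpha>) (\<lambda>g. \<kappa> (g + - s j))) < \<epsilon>"
    using eventually_happens' folner unfolding folner_def by blast
  have int: "set_integrable \<mu> (\<Lambda> \<alpha>) (\<lambda>g. \<kappa> (g + t))" for t
    by (rule bounded_set_integrable[OF \<alpha>(1) _ bound]) simp
  \<comment> \<open>A function that is at least \<open>\<epsilon>\<close> on the whole set has
    average at least \<open>\<epsilon>\<close>.\<close>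
  have "\<exists>g\<in>\<Lambda> \<alpha>. (\<Sum>j<N. \<kappa> (g + - s j)) < \<epsilon>"
  proof (rule ccontr)
    assume "\<not> ?thesis"
    then have "average \<mu> (\<Lambda> \<alpha>) (\<lambda>_. \<epsilon>) \<le> average \<mu> (\<Lambda> \<alpha>) (\<lambda>g. \<Sum>j<N. \<kappa> (g + - s j))"
      by (intro average_mono bounded_set_integrable[OF \<alpha>(1), of _ \<epsilon>] set_integrable_sum int)
        (use \<open>0 < \<epsilon>\<close> int in auto)
    also have "\<dots> = (\<Sum>j<N. average \<mu> (\<Lambda> \<alpha>) (\<lambda>g. \<kappa> (g + - s j)))"
      by (intro average_sum int) auto
    finally show False using \<alpha> by (simp add: average_const)
  qed
  then obtain g where g: "(\<Sum>j<N. \<kappa> (g - s j)) < \<epsilon>" by auto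
  \<comment> \<open>The summands are nonnegative, so each is below \<open>\<epsilon>\<close>; the
    symmetry of \<open>\<kappa>\<close> then gives both orders of the pair.\<close>
  have gj: "\<kappa> (g - s j) < \<epsilon>" "\<kappa> (s j - g) < \<epsilon>" if "j < N" for j
  proof -
    have "\<kappa> (g - s j) \<le> (\<Sum>j<N. \<kappa> (g - s j))"
      using that \<kappa>(2) by (intro member_le_sum) auto
    with g show "\<kappa> (g - s j) < \<epsilon>" by simp
    with \<kappa>(4)[of "g - s j"] show "\<kappa> (s j - g) < \<epsilon>" by simp
  qed
  show ?case
    using s gj by (intro exI[of _ "s(N := g)"]) (auto simp: less_Suc_eq)
qed

end

section \<open>Weakly mixing systems with a tracial state\<close>

text \<open>After division by the square of \<open>N\<close>, the diagonal costs only
  \<open>B / N\<close>, which a large \<open>N\<close> makes negligible, while the rest stays below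
  \<open>\<delta>\<close>.\<close>

lemma sum_sum_off_diagonal_le:
  fixes u :: "nat \<Rightarrow> nat \<Rightarrow> real"
  assumes "\<And>i. i < N \<Longrightarrow> u i i \<le> B"
    and "\<And>i j. i < N \<Longrightarrow> j < N \<Longrightarrow> i \<noteq> j \<Longrightarrow> u i j \<le> \<delta>" "0 \<le> \<delta>"
  shows "(\<Sum>i<N. \<Sum>j<N. u i j) \<le> real N * B + (real N)\<^sup>2 * \<delta>"
proof -
  have "(\<Sum>i<N. \<Sum>j<N. u i j) \<le> (\<Sum>i<N. \<Sum>j<N. (if j = i then B else 0) + \<delta>)"
    using assms by (intro sum_mono) (auto simp: add_increasing2)
  also have "\<dots> = real N * B + (real N)\<^sup>2 * \<delta>"
    by (simp add: sum.distrib power2_eq_square algebra_simps)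
  finally show ?thesis .
qed

lemma star_automorphism_props:
  assumes "star_automorphism f"
  shows "f (x + y) = f x + f y" "f (x * y) = f x * f y" "f (c *\<^sub>C x) = c *\<^sub>C f x"
    "f (star x) = star (f x)" "f (x - y) = f x - f y" "f 1 = 1"
proof -
  show add: "f (x + y) = f x + f y" and mult: "f (x * y) = f x * f y"
    and "f (c *\<^sub>C x) = c *\<^sub>C f x" "f (star x) = star (f x)" for x y
    using assms unfolding star_automorphism_def by auto
  show "f (x - y) = f x - f y"
    by (metis add add_diff_cancel_right' diff_add_cancel)
  \<comment> \<open>Unitality comes from surjectivity:
    \<open>f 1 = f 1 * f u = f (1 * u) = f u = 1\<close>.\<close>
  obtain u where "f u = 1"
    using assms unfolding star_automorphism_def by (metis bij_pointE)
  then show "f 1 = 1" by (metis mult mult.right_neutral mult.left_neutral)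
qed

section \<open>Correlations in a system with an invariant trace\<close>

locale tracial_cstar_dynamical_system = cstar_dynamical_system \<mu> \<omega> \<tau>
  for \<mu> :: "'g::ab_group_add measure"
    and \<omega> :: "'a::unital_cstar_algebra \<Rightarrow> complex"
    and \<tau> :: "'g \<Rightarrow> 'a \<Rightarrow> 'a" +
  assumes tracial: "tracial \<omega>"
begin

sublocale abelian_measure_group \<mu> ..

sublocale cstar_state_space \<omega>
  by unfold_locales (rule state)

lemma action_action: "\<tau> g (\<tau> h x) = \<tau> (g + h) x"
  using action_add[of g h] by (metis comp_apply)

lemma action_0 [simp]: "\<tau> 0 x = x"
  by (simp add: action_zero)

lemmas action_props = star_automorphism_props[OF automorphism]

lemma state_action [simp]: "\<omega> (\<tau> g x) = \<omega> x"
  using invariant[of g] by (metis comp_apply)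

lemma state_commute: "\<omega> (x * y) = \<omega> (y * x)"
  using tracial unfolding tracial_def by blast

lemma seminorm_sq_star: "seminorm_sq (star x) = seminorm_sq x"
  unfolding seminorm_sq_def by (simp add: star_star state_commute)

lemma seminorm_sq_action: "seminorm_sq (\<tau> g x) = seminorm_sq x"
  unfolding seminorm_sq_def by (simp add: action_props[symmetric])

lemma cmod_state_mult_le: "cmod (\<omega> (x * y)) \<le> sqrt (seminorm_sq x) * sqrt (seminorm_sq y)"
  using cauchy_schwarz[of "star x" y] by (simp add: star_star seminorm_sq_star)

lemma cmod_state_le_seminorm: "cmod (\<omega> x) \<le> sqrt (seminorm_sq x)"
  using cauchy_schwarz[of 1 x] by (simp add: seminorm_sq_def)

text \<open>
  The trace makes this bound uniform in \<open>h\<close> without knowing that *-automorphisms are isometric.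
\<close>

lemma seminorm_sq_action_mult_le:
  "seminorm_sq (\<tau> h x * y) \<le> sqrt (seminorm_sq (star x * x)) * sqrt (seminorm_sq (y * star y))"
proof -
  have "\<omega> (star (\<tau> h x * y) * (\<tau> h x * y)) = \<omega> (star y * (\<tau> h (star x * x) * y))"
    by (simp add: star_mult action_props mult.assoc)
  also have "\<dots> = \<omega> (\<tau> h (star x * x) * (y * star y))"
    by (subst state_commute) (simp add: mult.assoc)
  finally have "seminorm_sq (\<tau> h x * y) \<le> cmod (\<omega> (\<tau> h (star x * x) * (y * star y)))"
    unfolding seminorm_sq_def by (simp add: complex_Re_le_cmod)
  also have "\<dots> \<le> sqrt (seminorm_sq (star x * x)) * sqrt (seminorm_sq (y * star y))"
    using cmod_state_mult_le[of "\<tau> h (star x * x)" "y * star y"] by (simp only: seminorm_sq_action)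
  finally show ?thesis .
qed

text \<open>Invariance under \<open>\<tau> g\<close> leaves only the difference
  \<open>h - g\<close>, which is why only differences of the chosen points have to be
  controlled.\<close>

lemma state_star_action_mult_action: "\<omega> (star (\<tau> g x) * \<tau> h y) = \<omega> (star x * \<tau> (h - g) y)"
  using state_action[of g "star x * \<tau> (h - g) y"] by (simp add: action_props action_action)

text \<open>Phases \<open>c i\<close> turn the sum of moduli into a single value
  \<open>\<omega> (Y * z)\<close>. Cauchy-Schwarz separates \<open>z\<close>, and expanding the
  seminorm of \<open>Y\<close> leaves the correlations of \<open>x\<close>. The bound does not
  change when all \<open>s i\<close> are shifted by one group element.\<close>

lemma sum_cmod_state_le:
  "(\<Sum>i<N. cmod (\<omega> (\<tau> (s i) x * z)))
     \<le> sqrt (\<Sum>i<N. \<Sum>j<N. cmod (\<omega> (star x * \<tau> (s j - s i) x))) * sqrt (seminorm_sq z)"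
    (is "_ \<le> sqrt ?Q * _")
proof -
  define c where "c i = cnj (sgn (\<omega> (\<tau> (s i) x * z)))" for i
  define Y where "Y = (\<Sum>i<N. c i *\<^sub>C \<tau> (s i) x)"
  have cmod_c: "cmod (c i) \<le> 1" for i by (simp add: c_def norm_sgn)
  have c: "c i * \<omega> (\<tau> (s i) x * z) = of_real (cmod (\<omega> (\<tau> (s i) x * z)))" for i
    by (simp add: c_def sgn_eq complex_norm_square[symmetric] power2_eq_square mult.commute
        flip: complex_norm_square)
  have "\<omega> (Y * z) = of_real (\<Sum>i<N. cmod (\<omega> (\<tau> (s i) x * z)))"
    by (simp add: Y_def sum_distrib_right state_sum mult_scaleC_left state_scaleC c)
  then have "(\<Sum>i<N. cmod (\<omega> (\<tau> (s i) x * z))) = cmod (\<omega> (Y * z))"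
    by (simp only: norm_of_real) (simp add: sum_nonneg)
  also have "\<dots> \<le> sqrt (seminorm_sq Y) * sqrt (seminorm_sq z)"
    by (rule cmod_state_mult_le)
  also have "\<dots> \<le> sqrt ?Q * sqrt (seminorm_sq z)"
  proof (intro mult_right_mono real_sqrt_le_mono)
    have "\<omega> (star Y * Y) =
        (\<Sum>i<N. \<Sum>j<N. cnj (c i) * (c j * \<omega> (star x * \<tau> (s j - s i) x)))"
      by (simp add: Y_def star_sum sum_product state_sum star_scaleC mult_scaleC_left
          mult_scaleC_right state_scaleC state_star_action_mult_action)
        (simp add: mult.left_commute)
    then have "seminorm_sq Y \<le>
        cmod (\<Sum>i<N. \<Sum>j<N. cnj (c i) * (c j * \<omega> (star x * \<tau> (s j - s i) x)))"
      unfolding seminorm_sq_def by (simp only: complex_Re_le_cmod)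
    also have "\<dots> \<le> ?Q"
    proof (rule sum_norm_le, rule sum_norm_le)
      fix i j
      have "cmod (c i) * (cmod (c j) * v) \<le> 1 * (1 * v)" if "0 \<le> v" for v
        using that by (intro mult_mono cmod_c) auto
      from this[of "cmod (\<omega> (star x * \<tau> (s j - s i) x))"]
      show "cmod (cnj (c i) * (c j * \<omega> (star x * \<tau> (s j - s i) x)))
          \<le> cmod (\<omega> (star x * \<tau> (s j - s i) x))"
        by (simp only: norm_mult complex_mod_cnj norm_ge_zero mult_1)
    qed
    finally show "seminorm_sq Y \<le> ?Q" .
  qed simp
  finally show ?thesis .
qed

section \<open>Weak mixing along arbitrary Foelner nets, then the double average\<close>

lemma measurable_correlation': "(\<lambda>g. \<omega> (\<tau> g x * y)) \<in> borel_measurable \<mu>"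
  using measurable_correlation[of y x] by (simp add: state_commute)

lemma cmod_correlation_le: "cmod (\<omega> (\<tau> g x * y)) \<le> sqrt (seminorm_sq x) * sqrt (seminorm_sq y)"
  using cmod_state_mult_le[of "\<tau> g x" y] by (simp add: seminorm_sq_action)

lemma state_star_mult_action_uminus:
  "\<omega> (star x * \<tau> (- s) x) = cnj (\<omega> (star x * \<tau> s x))"
  using state_star[of "star x * \<tau> s x"] state_star_action_mult_action[of s x 0 x]
  by (simp add: star_mult star_star)

text \<open>The kernel is the sum of the two correlation defects, so that the same points serve
  \<open>a\<close> and \<open>b\<close>. The net supplied by weak mixing is used up here: what
  survives is a finite set of points, usable with any other Foelner net.\<close>

lemma weakly_mixing_separated_points:
  assumes "weakly_mixing \<mu> \<omega> \<tau>" "0 < \<delta>"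
  shows "\<exists>s::nat \<Rightarrow> 'g. \<forall>i<N. \<forall>j<N. i \<noteq> j \<longrightarrow>
    cmod (\<omega> (star a * \<tau> (s j - s i) a) - cnj (\<omega> a) * \<omega> a) < \<delta> \<and>
    cmod (\<omega> (star b * \<tau> (s j - s i) b) - cnj (\<omega> b) * \<omega> b) < \<delta>"
proof -
  obtain F where F: "folner \<mu> (\<lambda>\<Lambda>. \<Lambda>) F"
    and lim: "\<And>a b. ((\<lambda>\<Lambda>. (LINT g:\<Lambda>|\<mu>. cmod (\<omega> (a * \<tau> g b) - \<omega> a * \<omega> b)) / measure \<mu> \<Lambda>) \<longlongrightarrow> 0) F"
    using assms(1) unfolding weakly_mixing_def by auto
  define \<kappa>' where "\<kappa>' x g = cmod (\<omega> (star x * \<tau> g x) - cnj (\<omega> x) * \<omega> x)" for x g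
  define \<kappa> where "\<kappa> g = \<kappa>' a g + \<kappa>' b g" for g
  note measurable_correlation[measurable]
  have meas': "\<kappa>' x \<in> borel_measurable \<mu>" for x
    unfolding \<kappa>'_def by measurable
  have bound': "\<kappa>' x g \<le> seminorm_sq x + (cmod (\<omega> x))\<^sup>2" for x g
  proof -
    have "\<kappa>' x g \<le> cmod (\<omega> (star x * \<tau> g x)) + cmod (cnj (\<omega> x) * \<omega> x)"
      unfolding \<kappa>'_def by (rule norm_triangle_ineq4)
    also have "\<dots> \<le> seminorm_sq x + (cmod (\<omega> x))\<^sup>2"
      using cauchy_schwarz[of x "\<tau> g x"]
      by (simp add: seminorm_sq_action norm_mult power2_eq_square)
    finally show ?thesis .
  qed
  have sym': "\<kappa>' x (- g) = \<kappa>' x g" for x g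
  proof -
    have "\<omega> (star x * \<tau> (- g) x) - cnj (\<omega> x) * \<omega> x = cnj (\<omega> (star x * \<tau> g x) - cnj (\<omega> x) * \<omega> x)"
      by (simp add: state_star_mult_action_uminus)
    then show ?thesis unfolding \<kappa>'_def by (metis complex_mod_cnj)
  qed
  have lim': "((\<lambda>\<Lambda>. average \<mu> \<Lambda> (\<kappa>' x)) \<longlongrightarrow> 0) F" for x
    using lim[of "star x" x] by (simp add: \<kappa>'_def average_def state_star divide_inverse mult.commute)
  have "((\<lambda>\<Lambda>. average \<mu> \<Lambda> (\<kappa>' a) + average \<mu> \<Lambda> (\<kappa>' b)) \<longlongrightarrow> 0) F"
    using tendsto_add[OF lim'[of a] lim'[of b]] by simp
  moreover have "\<forall>\<^sub>F \<Lambda> in F. average \<mu> \<Lambda> (\<kappa>' a) + average \<mu> \<Lambda> (\<kappa>' b) = average \<mu> \<Lambda> \<kappa>"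
    using folner_boundary_ratio(1)[OF F]
  proof eventually_elim
    case (elim \<Lambda>)
    have "set_integrable \<mu> \<Lambda> (\<kappa>' x)" for x
      using bound'[of x]
      by (intro bounded_set_integrable[OF elim meas', where C = "seminorm_sq x + (cmod (\<omega> x))\<^sup>2"])
        (simp add: \<kappa>'_def)
    then show ?case unfolding \<kappa>_def by (simp add: average_add)
  qed
  ultimately have lim_\<kappa>: "((\<lambda>\<Lambda>. average \<mu> \<Lambda> \<kappa>) \<longlongrightarrow> 0) F" by (simp add: tendsto_cong)
  have meas: "\<kappa> \<in> borel_measurable \<mu>"
    using meas' unfolding \<kappa>_def by measurable
  have nonneg: "0 \<le> \<kappa>' x g" for x g by (simp add: \<kappa>'_def)
  have "\<exists>s::nat \<Rightarrow> 'g. \<forall>i<N. \<forall>j<N. i \<noteq> j \<longrightarrow> \<kappa> (s i - s j) < \<delta>"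
  proof (rule exists_separated_points[OF F meas _ _ _ lim_\<kappa> assms(2)])
    show "\<kappa> g \<le> seminorm_sq a + (cmod (\<omega> a))\<^sup>2 + (seminorm_sq b + (cmod (\<omega> b))\<^sup>2)" for g
      unfolding \<kappa>_def by (intro add_mono bound')
  qed (simp_all add: \<kappa>_def sym' nonneg)
  then obtain s :: "nat \<Rightarrow> 'g" where
      s: "\<And>i j. i < N \<Longrightarrow> j < N \<Longrightarrow> i \<noteq> j \<Longrightarrow> \<kappa> (s i - s j) < \<delta>"
    by blast
  show ?thesis
  proof (intro exI[of _ s] allI impI)
    fix i j assume "i < N" "j < N" "i \<noteq> j"
    with s[of j i] have "\<kappa>' a (s j - s i) + \<kappa>' b (s j - s i) < \<delta>"
      by (simp add: \<kappa>_def)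
    with nonneg[of a "s j - s i"] nonneg[of b "s j - s i"]
    have "\<kappa>' a (s j - s i) < \<delta> \<and> \<kappa>' b (s j - s i) < \<delta>"
      by linarith
    then show "cmod (\<omega> (star a * \<tau> (s j - s i) a) - cnj (\<omega> a) * \<omega> a) < \<delta> \<and>
        cmod (\<omega> (star b * \<tau> (s j - s i) b) - cnj (\<omega> b) * \<omega> b) < \<delta>"
      by (simp add: \<kappa>'_def)
  qed
qed

text \<open>Passes from the one net in the definition of weak mixing to every Foelner net, uniformly
  over translates: far out, any such net is almost invariant under the finitely many separated
  points.\<close>

lemma weakly_mixing_average_le:
  assumes wm: "weakly_mixing \<mu> \<omega> \<tau>" and fol: "folner \<mu> \<Lambda> F" and "0 < \<epsilon>"
  shows "\<forall>\<^sub>F \<alpha> in F. \<forall>t.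
    average \<mu> (right_translate (\<Lambda> \<alpha>) t) (\<lambda>h. cmod (\<omega> (\<tau> h a * b) - \<omega> a * \<omega> b)) \<le> \<epsilon>"
proof -
  define x where "x = a - \<omega> a *\<^sub>C 1"
  have x1: "\<omega> (\<tau> h a * b) - \<omega> a * \<omega> b = \<omega> (\<tau> h x * b)" for h
    by (simp add: x_def action_props left_diff_distrib mult_scaleC_left state_diff state_scaleC)
  have x2: "\<omega> (star x * \<tau> s x) = \<omega> (star a * \<tau> s a) - cnj (\<omega> a) * \<omega> a" for s
    by (simp add: x_def action_props star_diff star_scaleC left_diff_distrib right_diff_distrib
        mult_scaleC_left mult_scaleC_right state_diff state_scaleC state_star)
  define B K C where "B = seminorm_sq x" and "K = seminorm_sq b" and "C = sqrt B * sqrt K"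
  have nn: "0 \<le> B" "0 \<le> K" "0 \<le> C" by (simp_all add: B_def K_def C_def)
  \<comment> \<open>Chosen so that \<open>2 * \<delta> * (K + 1)\<close> is the square of
    \<open>\<epsilon> / 2\<close>. Below, \<open>N\<close> is taken so large that the diagonal terms
    cost no more than the off-diagonal ones. Adding 1 to \<open>K\<close>, and later to
    \<open>C\<close>, keeps denominators positive.\<close>
  define \<delta> where "\<delta> = \<epsilon>\<^sup>2 / (8 * (K + 1))"
  have "0 < \<delta>" using \<open>0 < \<epsilon>\<close> nn by (simp add: \<delta>_def)
  obtain N :: nat where N: "B / \<delta> < real N" using reals_Archimedean2 by blast
  have "0 < N" using N divide_nonneg_pos[OF nn(1) \<open>0 < \<delta>\<close>] by (cases N) auto
  obtain s :: "nat \<Rightarrow> 'g" where s: "\<And>i j. i < N \<Longrightarrow> j < N \<Longrightarrow> i \<noteq> j \<Longrightarrow>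
      cmod (\<omega> (star a * \<tau> (s j - s i) a) - cnj (\<omega> a) * \<omega> a) < \<delta>"
    using weakly_mixing_separated_points[OF wm \<open>0 < \<delta>\<close>, of N a a] by auto
  have sum: "(\<Sum>i<N. cmod (\<omega> (\<tau> (h + s i) x * b))) \<le> real N * (\<epsilon> / 2)" for h
  proof -
    have "(\<Sum>i<N. \<Sum>j<N. cmod (\<omega> (star x * \<tau> (s j - s i) x))) \<le> real N * B + (real N)\<^sup>2 * \<delta>"
    proof (rule sum_sum_off_diagonal_le)
      show "cmod (\<omega> (star x * \<tau> (s i - s i) x)) \<le> B" for i
        by (simp add: B_def state_star_mult_self)
      show "cmod (\<omega> (star x * \<tau> (s j - s i) x)) \<le> \<delta>" if "i < N" "j < N" "i \<noteq> j" for i j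
        unfolding x2 using s[OF that] by (rule less_imp_le)
    qed (rule less_imp_le[OF \<open>0 < \<delta>\<close>])
    also have "\<dots> \<le> real N * (real N * \<delta>) + (real N)\<^sup>2 * \<delta>"
      using N \<open>0 < \<delta>\<close> by (intro add_right_mono mult_left_mono) (auto simp: pos_divide_less_eq)
    also have "\<dots> = (real N)\<^sup>2 * (2 * \<delta>)"
      by (simp add: power2_eq_square)
    finally have Q: "(\<Sum>i<N. \<Sum>j<N. cmod (\<omega> (star x * \<tau> (s j - s i) x))) \<le> (real N)\<^sup>2 * (2 * \<delta>)" .
    have "(\<Sum>i<N. cmod (\<omega> (\<tau> (h + s i) x * b)))
        \<le> sqrt (\<Sum>i<N. \<Sum>j<N. cmod (\<omega> (star x * \<tau> (s j - s i) x))) * sqrt K"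
      using sum_cmod_state_le[of "\<lambda>i. h + s i" x b N] by (simp add: K_def)
    also have "\<dots> \<le> sqrt ((real N)\<^sup>2 * (2 * \<delta>)) * sqrt K"
      by (intro mult_right_mono real_sqrt_le_mono Q) (simp add: nn)
    also have "\<dots> = real N * sqrt (2 * \<delta> * K)"
      by (simp add: real_sqrt_mult)
    also have "\<dots> \<le> real N * sqrt ((\<epsilon> / 2)\<^sup>2)"
    proof (intro mult_left_mono real_sqrt_le_mono)
      have "2 * \<delta> * K \<le> 2 * \<delta> * (K + 1)" using \<open>0 < \<delta>\<close> by simp
      also have "\<dots> = (\<epsilon> / 2)\<^sup>2" using nn by (simp add: \<delta>_def power_divide divide_simps)
      finally show "2 * \<delta> * K \<le> (\<epsilon> / 2)\<^sup>2" .
    qed simp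
    finally show ?thesis using \<open>0 < \<epsilon>\<close> by simp
  qed
  define r where "r = \<epsilon> / (2 * (C + 1))"
  have "0 < r" "C * r \<le> \<epsilon> / 2" using \<open>0 < \<epsilon>\<close> nn by (simp_all add: r_def field_simps)
  define \<phi> where "\<phi> h = cmod (\<omega> (\<tau> h x * b))" for h
  have \<phi>: "\<phi> \<in> borel_measurable \<mu>" unfolding \<phi>_def
    using measurable_correlation' by measurable
  have "norm (\<phi> h) \<le> C" for h
    using cmod_correlation_le[of h x b] by (simp add: \<phi>_def C_def B_def K_def)
  moreover have "norm (\<Sum>i<N. \<phi> (h + s i)) \<le> real N * (\<epsilon> / 2)" for h
    using sum[of h] by (simp add: \<phi>_def sum_nonneg)
  ultimately have "\<forall>\<^sub>F \<alpha> in F. \<forall>t. norm (average \<mu> (right_translate (\<Lambda> \<alpha>) t) \<phi>) \<le> \<epsilon> / 2 + C * r"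
    using eventually_norm_average_le[OF fol \<open>0 < N\<close> \<open>0 < r\<close>, of s, where ?'b = real] \<phi>
    by (elim eventually_mono) blast
  then show ?thesis
  proof eventually_elim
    case (elim \<alpha>)
    then show ?case using \<open>C * r \<le> \<epsilon> / 2\<close> unfolding x1 \<phi>_def[symmetric]
      by (smt (verit) field_sum_of_halves real_norm_def)
  qed
qed


text \<open>The inner average is bounded by a function \<open>D\<close> of \<open>h\<close>, far out
  in the net but with one index for all \<open>h\<close>. The function \<open>D\<close> is affine in
  correlations of \<open>h\<close>, so the previous lemma controls its outer average.\<close>

lemma weakly_mixing_double_average:
  assumes wm: "weakly_mixing \<mu> \<omega> \<tau>" and sf: "sigma_finite_measure \<mu>"
    and meas: "(\<lambda>(g, h). \<omega> (\<tau> (g + h) a * \<tau> g b * \<tau> h c * d)) \<in> borel_measurable (\<mu> \<Otimes>\<^sub>M \<mu>)"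
    and fol1: "folner \<mu> \<Lambda>1 F" and fol2: "folner \<mu> \<Lambda>2 F" and "0 < \<epsilon>"
  shows "\<forall>\<^sub>F \<alpha> in F. \<forall>t1 t2.
    cmod (average \<mu> (right_translate (\<Lambda>1 \<alpha>) t1) (\<lambda>h.
        average \<mu> (right_translate (\<Lambda>2 \<alpha>) t2) (\<lambda>g. \<omega> (\<tau> (g + h) a * \<tau> g b * \<tau> h c * d)))
      - \<omega> a * \<omega> b * \<omega> c * \<omega> d) \<le> \<epsilon>"
proof -
  interpret sigma_finite_measure \<mu> by (rule sf)
  \<comment> \<open>\<open>X h\<close> is centred at the limiting mean \<open>m\<close> and not at
    its own state, so the remaining term \<open>m * \<omega> (Z h)\<close> does not depend on
    \<open>g\<close> and its outer average tends to the desired product.\<close>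
  define m where "m = \<omega> a * \<omega> b"
  define X where "X h = \<tau> h a * b - m *\<^sub>C 1" for h
  define Z where "Z h = \<tau> h c * d" for h
  have split: "\<omega> (\<tau> (g + h) a * \<tau> g b * \<tau> h c * d) = \<omega> (\<tau> g (X h) * Z h) + m * \<omega> (Z h)" for g h
    by (simp add: X_def Z_def action_props action_action left_diff_distrib mult_scaleC_left
        state_diff state_scaleC mult.assoc)

  \<comment> \<open>\<open>K\<close> and \<open>C\<close> bound \<open>seminorm_sq (Z h)\<close> and
    the \<open>g\<close>-integrand independently of \<open>h\<close>.\<close>
  define K where "K = sqrt (seminorm_sq (star c * c)) * sqrt (seminorm_sq (d * star d))"
  define C where "C = sqrt (sqrt (seminorm_sq (star a * a)) * sqrt (seminorm_sq (b * star b))) * sqrt K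
    + cmod m * sqrt K"
  have nn: "0 \<le> K" "0 \<le> C" by (simp_all add: K_def C_def)
  have K: "seminorm_sq (Z h) \<le> K" for h
    unfolding Z_def K_def by (rule seminorm_sq_action_mult_le)
  have C: "cmod (\<omega> (\<tau> g (X h) * Z h)) \<le> C" for g h
  proof -
    have "\<omega> (\<tau> g (X h) * Z h) = \<omega> (\<tau> g (\<tau> h a * b) * Z h) - m * \<omega> (Z h)"
      by (simp add: X_def action_props left_diff_distrib mult_scaleC_left state_diff state_scaleC)
    then have "cmod (\<omega> (\<tau> g (X h) * Z h)) \<le> cmod (\<omega> (\<tau> g (\<tau> h a * b) * Z h)) + cmod m * cmod (\<omega> (Z h))"
      by (metis norm_mult norm_triangle_ineq4)
    also have "\<dots> \<le> sqrt (seminorm_sq (\<tau> h a * b)) * sqrt (seminorm_sq (Z h)) + cmod m * sqrt (seminorm_sq (Z h))"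
      by (intro add_mono mult_left_mono cmod_correlation_le cmod_state_le_seminorm) auto
    also have "\<dots> \<le> C"
      unfolding C_def
      by (intro add_mono mult_mono mult_left_mono real_sqrt_le_mono K seminorm_sq_action_mult_le) auto
    finally show ?thesis .
  qed

  \<comment> \<open>The trace and commutativity of the group regroup the four factors of the
    correlation of \<open>\<tau> h a * b\<close> with its translate by \<open>s\<close> into
    \<open>\<omega> (\<tau> h (y s) * w s)\<close>, again a two-point correlation in
    \<open>h\<close>.\<close>
  define y w where "y s = star a * \<tau> s a" and "w s = \<tau> s b * star b" for s
  define \<Psi> where "\<Psi> s h = cmod (\<omega> (\<tau> h (y s) * w s) - \<omega> (y s) * \<omega> (w s))" for s h
  define \<Phi> where "\<Phi> h = cmod (\<omega> (\<tau> h a * b) - m)" for h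
  define T where "T s = cmod (\<omega> (y s) * \<omega> (w s) - cnj m * m)" for s
  have corr: "cmod (\<omega> (star (X h) * \<tau> s (X h))) \<le> \<Psi> s h + 2 * cmod m * \<Phi> h + T s" for s h
  proof -
    define p q where "p = \<omega> (\<tau> h a * b)" and "q = \<omega> (\<tau> h (y s) * w s)"
    have "\<omega> (star b * (star (\<tau> h a) * (\<tau> s (\<tau> h a) * \<tau> s b))) = q"
      unfolding q_def y_def w_def
      by (subst state_commute) (simp add: action_props action_action mult.assoc add.commute)
    moreover have "\<omega> (star b * star (\<tau> h a)) = cnj p"
      unfolding p_def by (simp flip: state_star star_mult)
    moreover have "\<omega> (\<tau> s (\<tau> h a) * \<tau> s b) = p"
      unfolding p_def by (simp flip: action_props(2))
    ultimately have "\<omega> (star (X h) * \<tau> s (X h)) = q - m * cnj p - cnj m * p + cnj m * m"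
      unfolding X_def
      by (simp add: action_props star_diff star_scaleC star_mult left_diff_distrib
          right_diff_distrib mult_scaleC_left mult_scaleC_right state_diff state_scaleC mult.assoc)
    \<comment> \<open>Expansion around the expected limits: the first three terms average out over
      \<open>h\<close>, the last is independent of \<open>h\<close> and small for separated
      points.\<close>
    also have "\<dots> = (q - \<omega> (y s) * \<omega> (w s)) - m * cnj (p - m) - cnj m * (p - m)
        + (\<omega> (y s) * \<omega> (w s) - cnj m * m)"
      by (simp add: algebra_simps)
    also have "cmod \<dots> \<le> cmod (q - \<omega> (y s) * \<omega> (w s)) + cmod (m * cnj (p - m))
        + cmod (cnj m * (p - m)) + cmod (\<omega> (y s) * \<omega> (w s) - cnj m * m)"
      by (intro norm_triangle_le add_mono order_refl norm_triangle_le_diff)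
    finally show ?thesis
      by (simp add: \<Psi>_def \<Phi>_def T_def p_def q_def norm_mult flip: complex_cnj_diff)
  qed
  have w_eq: "\<omega> (w s) = \<omega> (star b * \<tau> s b)" for s
    unfolding w_def by (rule state_commute)
  have cmod_w: "cmod (\<omega> (w s)) \<le> seminorm_sq b" for s
    using cauchy_schwarz[of b "\<tau> s b"] by (simp add: w_eq seminorm_sq_action)
  have cmod_y: "cmod (\<omega> (y s)) \<le> seminorm_sq a" for s
    using cauchy_schwarz[of a "\<tau> s a"] by (simp add: y_def seminorm_sq_action)
  \<comment> \<open>A crude bound for the diagonal, where \<open>s = 0\<close> and no smallness is
    available.\<close>
  define B where "B = seminorm_sq a * seminorm_sq b + (cmod m)\<^sup>2"
  have TB: "T s \<le> B" for s
  proof -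
    have "T s \<le> cmod (\<omega> (y s) * \<omega> (w s)) + cmod (cnj m * m)"
      unfolding T_def by (rule norm_triangle_ineq4)
    also have "\<dots> \<le> B"
      by (auto simp: norm_mult B_def power2_eq_square intro!: mult_mono cmod_w cmod_y)
    finally show ?thesis .
  qed
  define M where "M = seminorm_sq b + (cmod (\<omega> a))\<^sup>2"
  have T\<delta>: "T s \<le> \<delta> * M"
    if "cmod (\<omega> (y s) - cnj (\<omega> a) * \<omega> a) < \<delta>" "cmod (\<omega> (star b * \<tau> s b) - cnj (\<omega> b) * \<omega> b) < \<delta>"
    for s \<delta>
  proof -
    have "\<omega> (y s) * \<omega> (w s) - cnj m * m = (\<omega> (y s) - cnj (\<omega> a) * \<omega> a) * \<omega> (w s)
        + (cnj (\<omega> a) * \<omega> a) * (\<omega> (w s) - cnj (\<omega> b) * \<omega> b)"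
      by (simp add: m_def algebra_simps)
    then have "T s \<le> cmod (\<omega> (y s) - cnj (\<omega> a) * \<omega> a) * cmod (\<omega> (w s))
        + (cmod (\<omega> a))\<^sup>2 * cmod (\<omega> (w s) - cnj (\<omega> b) * \<omega> b)"
      unfolding T_def using norm_triangle_ineq
      by (metis norm_mult complex_mod_cnj power2_eq_square)
    also have "\<dots> \<le> \<delta> * seminorm_sq b + (cmod (\<omega> a))\<^sup>2 * \<delta>"
      using that by (intro add_mono mult_mono cmod_w) (auto simp: w_eq intro: less_imp_le order_trans[OF norm_ge_zero])
    finally show ?thesis by (simp add: M_def algebra_simps)
  qed

  \<comment> \<open>\<open>L\<close> collects every coefficient of \<open>\<delta>\<close> in the
    final estimate. The error is split into four quarters of \<open>\<epsilon>\<close>: one each for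
    \<open>\<eta>\<close>, for the diagonal through \<open>N\<close>, for \<open>C * r\<close> and
    for \<open>L * \<delta>\<close>.\<close>
  define L where "L = K / \<epsilon> * (1 + 2 * cmod m + M) + cmod m"
  have "0 \<le> M" by (simp add: M_def)
  have "0 \<le> L" using nn \<open>0 < \<epsilon>\<close> \<open>0 \<le> M\<close> by (simp add: L_def)
  define \<delta> where "\<delta> = (\<epsilon> / 4) / (L + 1)"
  have \<delta>: "0 < \<delta>" "L * \<delta> \<le> \<epsilon> / 4" using \<open>0 < \<epsilon>\<close> \<open>0 \<le> L\<close> by (simp_all add: \<delta>_def field_simps)
  define r where "r = (\<epsilon> / 4) / (C + 1)"
  have r: "0 < r" "C * r \<le> \<epsilon> / 4" using \<open>0 < \<epsilon>\<close> nn by (simp_all add: r_def field_simps)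
  obtain N0 :: nat where N0: "(K / \<epsilon>) * B / (\<epsilon> / 4) < real N0" using reals_Archimedean2 by blast
  define N where "N = Suc N0"
  have "0 < N" by (simp add: N_def)
  have "(K / \<epsilon>) * B / (\<epsilon> / 4) \<le> real N" using N0 by (simp add: N_def)
  then have NB: "(K / \<epsilon>) * B \<le> real N * (\<epsilon> / 4)" using \<open>0 < \<epsilon>\<close> by (simp add: pos_divide_le_eq)

  obtain s :: "nat \<Rightarrow> 'g" where
    sa: "\<And>i j. i < N \<Longrightarrow> j < N \<Longrightarrow> i \<noteq> j \<Longrightarrow>
      cmod (\<omega> (star a * \<tau> (s j - s i) a) - cnj (\<omega> a) * \<omega> a) < \<delta>" and
    sb: "\<And>i j. i < N \<Longrightarrow> j < N \<Longrightarrow> i \<noteq> j \<Longrightarrow>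
      cmod (\<omega> (star b * \<tau> (s j - s i) b) - cnj (\<omega> b) * \<omega> b) < \<delta>"
    using weakly_mixing_separated_points[OF wm \<delta>(1), of N a b] by auto
  \<comment> \<open>A majorant, with no square root, for the double sum of correlations of
    \<open>X h\<close>; it is averaged over \<open>h\<close> term by term.\<close>
  define R where "R h = (\<Sum>i<N. \<Sum>j<N. \<Psi> (s j - s i) h + (2 * cmod m * \<Phi> h + T (s j - s i)))" for h
  define \<eta> where "\<eta> = \<epsilon> / 4"
  define D where "D h = \<eta> + K / (\<epsilon> * (real N)\<^sup>2) * R h" for h
  have sumD: "cmod (\<Sum>i<N. \<omega> (\<tau> (g + s i) (X h) * Z h)) \<le> real N * D h" for g h
  proof -
    define Q where "Q = (\<Sum>i<N. \<Sum>j<N. cmod (\<omega> (star (X h) * \<tau> (s j - s i) (X h))))"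
    have Q: "Q \<le> R h"
      unfolding Q_def R_def using corr by (intro sum_mono) (auto simp: add.assoc)
    have "0 \<le> Q" unfolding Q_def by (intro sum_nonneg) auto
    have "cmod (\<Sum>i<N. \<omega> (\<tau> (g + s i) (X h) * Z h)) \<le> (\<Sum>i<N. cmod (\<omega> (\<tau> (g + s i) (X h) * Z h)))"
      by (rule norm_sum)
    also have "\<dots> \<le> sqrt Q * sqrt (seminorm_sq (Z h))"
      using sum_cmod_state_le[of "\<lambda>i. g + s i" "X h" "Z h" N] by (simp add: Q_def)
    also have "\<dots> \<le> sqrt (R h) * sqrt K"
      using Q K \<open>0 \<le> Q\<close> by (intro mult_mono real_sqrt_le_mono) auto
    also have "\<dots> \<le> real N * D h"
    proof -
      define u where "u = sqrt (R h) * sqrt K"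
      have u2: "u\<^sup>2 = R h * K" using Q \<open>0 \<le> Q\<close> nn by (simp add: u_def power_mult_distrib)
      \<comment> \<open>AM-GM: \<open>u \<le> N * \<epsilon> / 4 + u\<^sup>2 / (N * \<epsilon>)\<close>, which replaces \<open>sqrt (R h)\<close> by a quantity that is easy to average\<close>
      have "0 \<le> (u - real N * \<epsilon> / 2)\<^sup>2" by simp
      then have "u * (real N * \<epsilon>) \<le> u\<^sup>2 + (real N)\<^sup>2 * \<epsilon>\<^sup>2 / 4"
        by (simp add: power2_diff power_mult_distrib power_divide field_simps)
      then have "u \<le> (u\<^sup>2 + (real N)\<^sup>2 * \<epsilon>\<^sup>2 / 4) / (real N * \<epsilon>)"
        using \<open>0 < N\<close> \<open>0 < \<epsilon>\<close> by (simp add: pos_le_divide_eq)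
      also have "\<dots> = real N * D h"
        using \<open>0 < N\<close> \<open>0 < \<epsilon>\<close> unfolding u2 D_def \<eta>_def by (simp add: field_simps power2_eq_square)
      finally show ?thesis by (simp add: u_def)
    qed
    finally show ?thesis .
  qed

  note measurable_correlation'[measurable]
  \<comment> \<open>The integrand varies with \<open>h\<close>, but \<open>N\<close>,
    \<open>s\<close>, \<open>r\<close> and the bound \<open>C\<close> do not, so one index serves
    every \<open>h\<close>.\<close>
  have ev2: "\<forall>\<^sub>F \<alpha> in F. 0 < measure \<mu> (\<Lambda>2 \<alpha>) \<and> (\<forall>h t.
      cmod (average \<mu> (right_translate (\<Lambda>2 \<alpha>) t) (\<lambda>g. \<omega> (\<tau> g (X h) * Z h))) \<le> D h + C * r)"
    using eventually_norm_average_le[OF fol2 \<open>0 < N\<close> r(1), of s, where ?'b = complex]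
  proof (rule eventually_mono)
    fix \<alpha>
    assume *: "0 < measure \<mu> (\<Lambda>2 \<alpha>) \<and> (\<forall>t (f::'g \<Rightarrow> complex) C D.
      f \<in> borel_measurable \<mu> \<longrightarrow> (\<forall>g. norm (f g) \<le> C) \<longrightarrow>
      (\<forall>g. norm (\<Sum>i<N. f (g + s i)) \<le> real N * D) \<longrightarrow>
      norm (average \<mu> (right_translate (\<Lambda>2 \<alpha>) t) f) \<le> D + C * r)"
    show "0 < measure \<mu> (\<Lambda>2 \<alpha>) \<and> (\<forall>h t.
      cmod (average \<mu> (right_translate (\<Lambda>2 \<alpha>) t) (\<lambda>g. \<omega> (\<tau> g (X h) * Z h))) \<le> D h + C * r)"
      using *[THEN conjunct1] *[THEN conjunct2, rule_format, OF measurable_correlation' C sumD] by simp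
  qed
  \<comment> \<open>Only finitely many differences occur, so their eventual bounds hold
    jointly.\<close>
  have ev_\<Psi>: "\<forall>\<^sub>F \<alpha> in F. \<forall>p\<in>{..<N} \<times> {..<N}. \<forall>t.
      average \<mu> (right_translate (\<Lambda>1 \<alpha>) t) (\<Psi> (s (snd p) - s (fst p))) \<le> \<delta>"
    unfolding \<Psi>_def
    by (intro eventually_ball_finite ballI weakly_mixing_average_le[OF wm fol1 \<delta>(1)]) auto
  have ev_\<Phi>: "\<forall>\<^sub>F \<alpha> in F. \<forall>t. average \<mu> (right_translate (\<Lambda>1 \<alpha>) t) \<Phi> \<le> \<delta>"
    unfolding \<Phi>_def m_def by (rule weakly_mixing_average_le[OF wm fol1 \<delta>(1)])
  define \<xi> where "\<xi> h = cmod (\<omega> (Z h) - \<omega> c * \<omega> d)" for h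
  have ev_Z: "\<forall>\<^sub>F \<alpha> in F. \<forall>t. average \<mu> (right_translate (\<Lambda>1 \<alpha>) t) \<xi> \<le> \<delta>"
    unfolding \<xi>_def Z_def by (rule weakly_mixing_average_le[OF wm fol1 \<delta>(1)])
  show ?thesis
    using folner_boundary_ratio(1)[OF fol1] ev2 ev_\<Psi> ev_\<Phi> ev_Z
  proof eventually_elim
    case (elim \<alpha>)
    show ?case
    proof (intro allI)
      fix t1 t2
      let ?V = "right_translate (\<Lambda>1 \<alpha>) t1" and ?W = "right_translate (\<Lambda>2 \<alpha>) t2"
      have V: "0 < measure \<mu> ?V" and W: "0 < measure \<mu> ?W"
        using elim by (simp_all add: measure_right_translate)
      have int_corr: "set_integrable \<mu> ?V (\<lambda>h. cmod (\<omega> (\<tau> h p * q) - v))" for p q v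
      proof (rule bounded_set_integrable[OF V])
        show "norm (cmod (\<omega> (\<tau> h p * q) - v)) \<le> sqrt (seminorm_sq p) * sqrt (seminorm_sq q) + cmod v" for h
          using cmod_correlation_le[of h p q] norm_triangle_ineq4[of "\<omega> (\<tau> h p * q)" v] by simp
      qed measurable
      have int_const: "set_integrable \<mu> ?V (\<lambda>h. v)" for v :: real
        by (rule bounded_set_integrable[OF V, where C = "\<bar>v\<bar>"]) auto
      have int_\<Psi>: "set_integrable \<mu> ?V (\<Psi> s)" for s unfolding \<Psi>_def by (rule int_corr)
      have int_\<Phi>: "set_integrable \<mu> ?V (\<lambda>h. 2 * cmod m * \<Phi> h)"
        unfolding \<Phi>_def by (intro set_integrable_mult_right int_corr)
      have int_\<xi>: "set_integrable \<mu> ?V (\<lambda>h. cmod m * \<xi> h)"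
        unfolding \<xi>_def Z_def by (intro set_integrable_mult_right int_corr)
      have int_term: "set_integrable \<mu> ?V (\<lambda>h. \<Psi> s h + (2 * cmod m * \<Phi> h + T s))" for s
        by (intro set_integral_add int_\<Psi> int_\<Phi> int_const)
      have int_R: "set_integrable \<mu> ?V R"
        unfolding R_def by (intro set_integrable_sum int_term)
      have int_D: "set_integrable \<mu> ?V D"
        unfolding D_def by (intro set_integral_add set_integrable_mult_right int_R int_const)
      have avg_term: "average \<mu> ?V (\<lambda>h. \<Psi> s' h + (2 * cmod m * \<Phi> h + T s'))
          = average \<mu> ?V (\<Psi> s') + (2 * cmod m * average \<mu> ?V \<Phi> + T s')" for s'
        by (simp only: average_add[OF int_\<Psi> set_integral_add(1)[OF int_\<Phi> int_const]]
            average_add[OF int_\<Phi> int_const] average_cmult average_const[OF V])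
      have avg_R: "average \<mu> ?V R \<le> real N * B + (real N)\<^sup>2 * (\<delta> * (1 + 2 * cmod m + M))"
      proof -
        have "average \<mu> ?V R = (\<Sum>i<N. \<Sum>j<N. average \<mu> ?V (\<Psi> (s j - s i))
            + (2 * cmod m * average \<mu> ?V \<Phi> + T (s j - s i)))"
          unfolding R_def by (simp add: average_sum int_term set_integrable_sum avg_term)
        also have "\<dots> \<le> (\<Sum>i<N. \<Sum>j<N. (\<delta> + 2 * cmod m * \<delta>) + T (s j - s i))"
          using elim by (intro sum_mono) (auto simp: add.assoc intro!: add_mono mult_left_mono)
        also have "\<dots> = (real N)\<^sup>2 * (\<delta> + 2 * cmod m * \<delta>) + (\<Sum>i<N. \<Sum>j<N. T (s j - s i))"
          by (simp add: sum.distrib power2_eq_square algebra_simps)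
        also have "\<dots> \<le> (real N)\<^sup>2 * (\<delta> + 2 * cmod m * \<delta>) + (real N * B + (real N)\<^sup>2 * (\<delta> * M))"
          using sa sb \<delta>(1) \<open>0 \<le> M\<close>
          by (intro add_left_mono sum_sum_off_diagonal_le TB T\<delta>) (auto simp: y_def)
        finally show ?thesis by (simp add: algebra_simps)
      qed
      have avg_D: "average \<mu> ?V D \<le> \<epsilon> / 4 + (K / \<epsilon> * (\<delta> * (1 + 2 * cmod m + M)) + \<epsilon> / 4)"
      proof -
        have "average \<mu> ?V D = \<eta> + K / (\<epsilon> * (real N)\<^sup>2) * average \<mu> ?V R"
          unfolding D_def
          by (simp only: average_add[OF int_const set_integrable_mult_right[OF int_R]]
              average_cmult average_const[OF V])
        also have "\<dots> \<le> \<eta> + K / (\<epsilon> * (real N)\<^sup>2) * (real N * B + (real N)\<^sup>2 * (\<delta> * (1 + 2 * cmod m + M)))"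
          using nn \<open>0 < \<epsilon>\<close> by (intro add_left_mono mult_left_mono avg_R) auto
        also have "\<dots> = \<eta> + (K / \<epsilon> * (\<delta> * (1 + 2 * cmod m + M)) + (K / \<epsilon>) * B / real N)"
          using \<open>0 < N\<close> \<open>0 < \<epsilon>\<close> by (simp add: field_simps power2_eq_square)
        also have "\<dots> \<le> \<epsilon> / 4 + (K / \<epsilon> * (\<delta> * (1 + 2 * cmod m + M)) + \<epsilon> / 4)"
        proof -
          have "(K / \<epsilon>) * B / real N \<le> \<epsilon> / 4"
            using NB \<open>0 < N\<close> by (subst pos_divide_le_eq) (auto simp: mult.commute)
          then show ?thesis unfolding \<eta>_def by (intro add_left_mono)
        qed
        finally show ?thesis .
      qed
      define f where "f h = average \<mu> ?W (\<lambda>g. \<omega> (\<tau> (g + h) a * \<tau> g b * \<tau> h c * d))" for h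
      have f: "cmod (f h - m * (\<omega> c * \<omega> d)) \<le> D h + (C * r + cmod m * \<xi> h)" for h
      proof -
        have "f h = average \<mu> ?W (\<lambda>g. \<omega> (\<tau> g (X h) * Z h)) + m * \<omega> (Z h)"
          unfolding f_def split
          by (simp only: average_const[OF W] average_add[OF
              bounded_set_integrable[OF W measurable_correlation' C]
              bounded_set_integrable[OF W measurable_const order_refl]] UNIV_I space_borel)
        then have "f h - m * (\<omega> c * \<omega> d)
            = average \<mu> ?W (\<lambda>g. \<omega> (\<tau> g (X h) * Z h)) + m * (\<omega> (Z h) - \<omega> c * \<omega> d)"
          by (simp add: algebra_simps)
        also have "cmod \<dots> \<le> (D h + C * r) + cmod m * \<xi> h"
          using elim by (intro norm_triangle_le add_mono) (auto simp: norm_mult \<xi>_def)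
        finally show ?thesis by simp
      qed
      \<comment> \<open>Joint measurability and sigma-finiteness enter here: they make the inner
        average measurable in \<open>h\<close>.\<close>
      have int_f: "set_integrable \<mu> ?V f"
      proof (rule bounded_set_integrable[OF V])
        note sets = measure_pos_imp[OF W]
        have "(\<lambda>(h, g). indicator ?W g *\<^sub>R \<omega> (\<tau> (g + h) a * \<tau> g b * \<tau> h c * d))
            \<in> borel_measurable (\<mu> \<Otimes>\<^sub>M \<mu>)"
          using measurable_compose[OF measurable_pair_swap' meas] sets(1)
          by (auto simp: case_prod_unfold intro!: borel_measurable_scaleR borel_measurable_indicator'
              borel_measurable_indicator[THEN measurable_compose[OF measurable_snd]])
        then have "(\<lambda>h. LINT g:?W|\<mu>. \<omega> (\<tau> (g + h) a * \<tau> g b * \<tau> h c * d)) \<in> borel_measurable \<mu>"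
          unfolding set_lebesgue_integral_def by (rule borel_measurable_lebesgue_integral)
        then show "f \<in> borel_measurable \<mu>"
          unfolding f_def average_def by simp
        show "cmod (f h) \<le> C + cmod m * sqrt K" for h
        proof -
          have "cmod (\<omega> (\<tau> (g + h) a * \<tau> g b * \<tau> h c * d)) \<le> C + cmod m * sqrt K" for g
          proof -
            have "cmod (\<omega> (Z h)) \<le> sqrt K"
              using cmod_state_le_seminorm[of "Z h"] K[of h] real_sqrt_le_mono order_trans by blast
            then show ?thesis unfolding split using C
              by (intro norm_triangle_le add_mono) (auto simp: norm_mult mult_left_mono)
          qed
          then have "cmod (f h) \<le> average \<mu> ?W (\<lambda>_. C + cmod m * sqrt K)"
            unfolding f_def
            by (intro norm_average_le bounded_set_integrable[OF W, where C = "\<bar>C + cmod m * sqrt K\<bar>"]) auto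
          then show ?thesis by (simp add: average_const[OF W])
        qed
      qed
      have "average \<mu> ?V f - \<omega> a * \<omega> b * \<omega> c * \<omega> d = average \<mu> ?V (\<lambda>h. f h - m * (\<omega> c * \<omega> d))"
        by (simp add: average_diff[OF int_f bounded_set_integrable[OF V _ order_refl]]
            average_const[OF V] m_def mult.assoc)
      also have "cmod \<dots> \<le> average \<mu> ?V (\<lambda>h. D h + (C * r + cmod m * \<xi> h))"
        using f by (intro norm_average_le set_integral_add int_D int_const int_\<xi>) auto
      also have "\<dots> = average \<mu> ?V D + (C * r + cmod m * average \<mu> ?V \<xi>)"
        by (simp only: average_add[OF int_D set_integral_add(1)[OF int_const int_\<xi>]]
            average_add[OF int_const int_\<xi>] average_cmult average_const[OF V])
      also have "\<dots> \<le> (\<epsilon> / 4 + (K / \<epsilon> * (\<delta> * (1 + 2 * cmod m + M)) + \<epsilon> / 4)) + (\<epsilon> / 4 + cmod m * \<delta>)"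
        using avg_D r(2) elim by (intro add_mono mult_left_mono) auto
      also have "\<dots> = 3 * (\<epsilon> / 4) + L * \<delta>"
        by (simp add: L_def algebra_simps)
      also have "\<dots> \<le> \<epsilon>" using \<delta>(2) by simp
      finally show "cmod (average \<mu> ?V (\<lambda>h. average \<mu> ?W (\<lambda>g. \<omega> (\<tau> (g + h) a * \<tau> g b * \<tau> h c * d)))
          - \<omega> a * \<omega> b * \<omega> c * \<omega> d) \<le> \<epsilon>"
        unfolding f_def .
    qed
  qed
qed

end

section \<open>The double limit\<close>

text \<open>Finite counting measure makes \<open>V\<close> finite. The sigma-algebra may be coarser
  than the power set, so the restricted measure is identified as the push-forward of
  \<open>count_space V\<close> under the identity map, and the integral is pulled back to a finite
  sum.\<close>

lemma set_integral_counting: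
  fixes f :: "'g \<Rightarrow> 'b::{banach, second_countable_topology}"
  assumes count: "is_counting_measure \<mu>" and "space \<mu> = UNIV" and V: "0 < measure \<mu> V"
    and f: "f \<in> borel_measurable \<mu>"
  shows "(LINT g:V|\<mu>. f g) = (\<Sum>g\<in>V. f g)"
proof -
  note sets = measure_pos_imp[OF V]
  have "emeasure (count_space UNIV) V < \<infinity>"
    using count sets unfolding is_counting_measure_def by simp
  then have fin: "finite V"
    by (metis emeasure_count_space_infinite infinity_ennreal_def less_irrefl subset_UNIV)
  have sub: "A \<subseteq> V \<and> A \<in> sets \<mu>" if "A \<in> sets (restrict_space \<mu> V)" for A
    using that sets by (auto simp: sets_restrict_space)
  have space: "space (restrict_space \<mu> V) = V"
    using assms(2) by (simp add: space_restrict_space)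
  have meas: "(\<lambda>g. g) \<in> measurable (count_space V) (restrict_space \<mu> V)"
    using space by (intro measurableI) auto
  have distr: "restrict_space \<mu> V = distr (count_space V) (restrict_space \<mu> V) (\<lambda>g. g)"
  proof (rule measure_eqI)
    fix A assume A: "A \<in> sets (restrict_space \<mu> V)"
    then have "emeasure (restrict_space \<mu> V) A = emeasure \<mu> A"
      using sub sets assms(2) by (intro emeasure_restrict_space) auto
    also have "\<dots> = emeasure (count_space UNIV) A"
      using count sub[OF A] unfolding is_counting_measure_def by simp
    also have "\<dots> = emeasure (count_space V) A"
      using sub[OF A] fin finite_subset by (subst (1 2) emeasure_count_space_finite) auto
    also have "\<dots> = emeasure (distr (count_space V) (restrict_space \<mu> V) (\<lambda>g. g)) A"
      using sub[OF A] by (simp add: emeasure_distr[OF meas A] Int_absorb2)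
    finally show "emeasure (restrict_space \<mu> V) A
        = emeasure (distr (count_space V) (restrict_space \<mu> V) (\<lambda>g. g)) A" .
  qed simp
  have "(LINT g:V|\<mu>. f g) = integral\<^sup>L (restrict_space \<mu> V) f"
    unfolding set_lebesgue_integral_def
    using sets assms(2) by (subst integral_restrict_space) auto
  also have "\<dots> = integral\<^sup>L (count_space V) f"
    by (subst distr, subst integral_distr[OF meas]) (use f in \<open>auto intro: measurable_restrict_space1\<close>)
  also have "\<dots> = (\<Sum>g\<in>V. f g)"
    by (rule lebesgue_integral_count_space_finite[OF fin])
  finally show ?thesis .
qed

theorem theorem5p6:
  fixes \<mu> :: "'g::{topological_ab_group_add, second_countable_topology} measure"
    and \<omega> :: "'a::unital_cstar_algebra \<Rightarrow> complex"
    and \<tau> :: "'g \<Rightarrow> 'a \<Rightarrow> 'a"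
    and \<Lambda>1 \<Lambda>2 :: "nat \<Rightarrow> 'g set"
  assumes "cstar_dynamical_system \<mu> \<omega> \<tau>"
    and "weakly_mixing \<mu> \<omega> \<tau>"
    and "tracial \<omega>"
    and "sets \<mu> = sets borel"
    and "sigma_finite_measure \<mu>"
    and "\<And>a1 a2 a3 a4 a5 a6.
      (\<lambda>((g, h), (j, k)).
          \<omega> (\<tau> h a1 * \<tau> g a2 * \<tau> (g + h) a3 * \<tau> (j + k) a4 * \<tau> j a5 * \<tau> k a6))
        \<in> borel_measurable ((\<mu> \<Otimes>\<^sub>M \<mu>) \<Otimes>\<^sub>M (\<mu> \<Otimes>\<^sub>M \<mu>))"
    and "uniform_folner \<mu> \<Lambda>1 sequentially"
    and "uniform_folner \<mu> \<Lambda>2 sequentially"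
    and "tempelman \<mu> \<Lambda>1 sequentially"
    and "tempelman \<mu> \<Lambda>2 sequentially"
    and "folner \<mu> (\<lambda>n. difference_set (\<Lambda>1 n)) sequentially"
    and "folner \<mu> (\<lambda>n. difference_set (\<Lambda>2 n)) sequentially"
  shows "(asymptotically_abelian \<mu> \<tau> \<Lambda>1 sequentially \<longrightarrow>
      (\<forall>a b c d.
        (\<lambda>n. (LINT h:\<Lambda>1 n|\<mu>. (LINT g:\<Lambda>2 n|\<mu>. \<omega> (\<tau> (g + h) a * \<tau> g b * \<tau> h c * d)))
              / complex_of_real (measure \<mu> (\<Lambda>1 n) * measure \<mu> (\<Lambda>2 n)))
          \<longlonglongrightarrow> \<omega> a * \<omega> b * \<omega> c * \<omega> d)) \<and>
    (is_counting_measure \<mu> \<and> uniformly_asymptotically_abelian \<mu> \<tau> \<Lambda>1 sequentially \<longrightarrow>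
      (\<forall>a b c d.
        (\<lambda>n. SUP (g1, g2) \<in> UNIV.
              cmod ((\<Sum>h\<in>right_translate (\<Lambda>1 n) g1. \<Sum>g\<in>right_translate (\<Lambda>2 n) g2.
                        \<omega> (\<tau> (g + h) a * \<tau> g b * \<tau> h c * d))
                      / complex_of_real (measure \<mu> (\<Lambda>1 n) * measure \<mu> (\<Lambda>2 n))
                    - \<omega> a * \<omega> b * \<omega> c * \<omega> d))
          \<longlonglongrightarrow> 0))"
proof -
  interpret tracial_cstar_dynamical_system \<mu> \<omega> \<tau>
    using assms(1,3) by (intro tracial_cstar_dynamical_system.intro
        tracial_cstar_dynamical_system_axioms.intro)
  have fol1: "folner \<mu> \<Lambda>1 sequentially" and fol2: "folner \<mu> \<Lambda>2 sequentially"
    using assms(7,8) unfolding uniform_folner_def by auto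
  interpret sf: sigma_finite_measure \<mu> by fact
  \<comment> \<open>One family serves both claims: \<open>t1 = t2 = 0\<close> gives the first limit,
    and uniformity in \<open>t1\<close> and \<open>t2\<close> gives the supremum in the
    second.\<close>
  define I where "I a b c d n t1 t2 = average \<mu> (right_translate (\<Lambda>1 n) t1) (\<lambda>h.
    average \<mu> (right_translate (\<Lambda>2 n) t2) (\<lambda>g. \<omega> (\<tau> (g + h) a * \<tau> g b * \<tau> h c * d)))"
    for a b c d n t1 t2
  have meas: "(\<lambda>(g, h). \<omega> (\<tau> (g + h) a * \<tau> g b * \<tau> h c * d)) \<in> borel_measurable (\<mu> \<Otimes>\<^sub>M \<mu>)" for a b c d
  proof -
    \<comment> \<open>setting \<open>g = h = 0\<close> in the assumption and moving \<open>d\<close> to the end by the trace property\<close>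
    have "(\<lambda>x. ((0, 0), x)) \<in> measurable (\<mu> \<Otimes>\<^sub>M \<mu>) ((\<mu> \<Otimes>\<^sub>M \<mu>) \<Otimes>\<^sub>M (\<mu> \<Otimes>\<^sub>M \<mu>))"
      by (rule measurable_Pair1') (simp add: space_pair_measure space_eq_UNIV)
    from measurable_compose[OF this assms(6)[of d 1 1 a b c]]
    have "(\<lambda>(j, k). \<omega> (d * (\<tau> (j + k) a * \<tau> j b * \<tau> k c))) \<in> borel_measurable (\<mu> \<Otimes>\<^sub>M \<mu>)"
      by (simp add: action_props case_prod_unfold mult.assoc)
    then show ?thesis by (subst state_commute)
  qed
  have ev: "\<forall>\<^sub>F n in sequentially. \<forall>t1 t2. cmod (I a b c d n t1 t2 - \<omega> a * \<omega> b * \<omega> c * \<omega> d) \<le> \<epsilon>"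
    if "0 < \<epsilon>" for a b c d \<epsilon>
    unfolding I_def
    by (rule weakly_mixing_double_average[OF assms(2,5) meas fol1 fol2 that])
  have I_eq: "I a b c d n t1 t2 =
      (LINT h:right_translate (\<Lambda>1 n) t1|\<mu>. LINT g:right_translate (\<Lambda>2 n) t2|\<mu>.
        \<omega> (\<tau> (g + h) a * \<tau> g b * \<tau> h c * d))
      / complex_of_real (measure \<mu> (\<Lambda>1 n) * measure \<mu> (\<Lambda>2 n))" for a b c d n t1 t2
    unfolding I_def average_def measure_right_translate
    by (simp add: scaleR_conv_of_real field_simps)
  show ?thesis
  proof (intro conjI impI allI)
    fix a b c d
    have "(\<lambda>n. I a b c d n 0 0) \<longlonglongrightarrow> \<omega> a * \<omega> b * \<omega> c * \<omega> d"
    proof (rule tendstoI)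
      fix e :: real assume "0 < e"
      then show "\<forall>\<^sub>F n in sequentially. dist (I a b c d n 0 0) (\<omega> a * \<omega> b * \<omega> c * \<omega> d) < e"
        using eventually_mono[OF ev[of "e / 2" a b c d]]
        by (smt (verit, best) dist_norm field_sum_of_halves)
    qed
    then show "(\<lambda>n. (LINT h:\<Lambda>1 n|\<mu>. (LINT g:\<Lambda>2 n|\<mu>. \<omega> (\<tau> (g + h) a * \<tau> g b * \<tau> h c * d)))
              / complex_of_real (measure \<mu> (\<Lambda>1 n) * measure \<mu> (\<Lambda>2 n)))
          \<longlonglongrightarrow> \<omega> a * \<omega> b * \<omega> c * \<omega> d"
      by (simp add: I_eq right_translate_def)
  next
    fix a b c d
    assume "is_counting_measure \<mu> \<and> uniformly_asymptotically_abelian \<mu> \<tau> \<Lambda>1 sequentially"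
    then have count: "is_counting_measure \<mu>" by simp
    define P where "P = \<omega> a * \<omega> b * \<omega> c * \<omega> d"
    have sum_eq: "(\<Sum>h\<in>V. \<Sum>g\<in>W. \<omega> (\<tau> (g + h) a * \<tau> g b * \<tau> h c * d))
        = (LINT h:V|\<mu>. LINT g:W|\<mu>. \<omega> (\<tau> (g + h) a * \<tau> g b * \<tau> h c * d))"
      if V: "0 < measure \<mu> V" and W: "0 < measure \<mu> W" for V W
    proof -
      note meas[of a b c d, measurable]
      have "(\<lambda>g. \<omega> (\<tau> (g + h) a * \<tau> g b * \<tau> h c * d)) \<in> borel_measurable \<mu>" for h
        using measurable_compose[OF measurable_Pair2'[of h \<mu> \<mu>] meas[of a b c d]]
        by (simp add: space_eq_UNIV)
      then have inner: "(LINT g:W|\<mu>. \<omega> (\<tau> (g + h) a * \<tau> g b * \<tau> h c * d))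
          = (\<Sum>g\<in>W. \<omega> (\<tau> (g + h) a * \<tau> g b * \<tau> h c * d))" for h
        by (rule set_integral_counting[OF count space_eq_UNIV W])
      have "(\<lambda>h. \<omega> (\<tau> (g + h) a * \<tau> g b * \<tau> h c * d)) \<in> borel_measurable \<mu>" for g
        using measurable_compose[OF measurable_Pair1'[of g \<mu> \<mu>] meas[of a b c d]]
        by (simp add: space_eq_UNIV)
      then show ?thesis
        unfolding inner
        by (intro set_integral_counting[OF count space_eq_UNIV V, symmetric] borel_measurable_sum)
    qed
    show "(\<lambda>n. SUP (g1, g2) \<in> UNIV.
              cmod ((\<Sum>h\<in>right_translate (\<Lambda>1 n) g1. \<Sum>g\<in>right_translate (\<Lambda>2 n) g2.
                        \<omega> (\<tau> (g + h) a * \<tau> g b * \<tau> h c * d))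
                      / complex_of_real (measure \<mu> (\<Lambda>1 n) * measure \<mu> (\<Lambda>2 n))
                    - \<omega> a * \<omega> b * \<omega> c * \<omega> d))
          \<longlonglongrightarrow> 0" (is "?S \<longlonglongrightarrow> 0")
    proof (rule tendstoI)
      fix e :: real assume "0 < e"
      then have "0 < e / 2" by simp
      from ev[OF this, of a b c d] folner_boundary_ratio(1)[OF fol1] folner_boundary_ratio(1)[OF fol2]
      show "\<forall>\<^sub>F n in sequentially. dist (?S n) 0 < e"
      proof eventually_elim
        case (elim n)
        \<comment> \<open>Both measures are positive far out in the sequence, so the finite sums are
          integrals and the supremum runs over the values of \<open>I\<close>.\<close>
        have S: "?S n = (SUP t. cmod (I a b c d n (fst t) (snd t) - P))"
          using elim by (simp add: sum_eq measure_right_translate I_eq P_def case_prod_unfold)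
        have le: "cmod (I a b c d n (fst t) (snd t) - P) \<le> e / 2" for t
          using elim by (simp add: P_def)
        have "?S n \<le> e / 2"
          unfolding S by (rule cSUP_least) (use le in auto)
        \<comment> \<open>A real supremum dominates its members only for a family bounded above;
          \<open>le\<close> supplies that bound.\<close>
        moreover have "0 \<le> ?S n"
          unfolding S
          by (rule order_trans[OF norm_ge_zero cSUP_upper[of 0]]) (auto intro!: bdd_aboveI2 le)
        ultimately show ?case using \<open>0 < e\<close> by simp
      qed
    qed
  qed
qed

end
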